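(* Let $d=d_{\mathrm h}+d_{\mathrm p}$ with integers $1\le d_{\mathrm h}<d$ and $1\le d_{\mathrm p}<d$, let $m\in\{1,\dots,d\}$, let $D\in\mathcal M_{d_{\mathrm p}}(\mathbb R)$ satisfy $\mathrm{Re}(\mathrm{Sp}(D))\subset(0,+\infty)$, let $B=\begin{pmatrix}0&0\\0&D\end{pmatrix}\in\mathcal M_d(\mathbb R)$, let $A=\begin{pmatrix}A'&A_{12}\\ A_{21}&A_{22}\end{pmatrix}\in\mathcal M_d(\mathbb R)$ where $A'\in\mathcal M_{d_{\mathrm h}}(\mathbb R)$ is diagonalizable with $\mathrm{Sp}(A')\subset\mathbb R$, let $K\in\mathcal M_d(\mathbb R)$ and $M\in\mathcal M_{d,m}(\mathbb R)$. Let $\omega$ be a nonempty open subset of $\mathbb T$. Let $\mu\in\mathrm{Sp}(A')$, $N\in\mathbb N$ and $T>0$. Assume that every $f_0\in L^2(\mathbb T)^d$ of the form $f_0=\sum_{|n|>N}X_n\mathrm e^{\mathrm inx}$ (i.e. whose Fourier coefficients of index $|n|\le N$ vanish) is steerable to $0$ in time $T$ with control in $L^2((0,T)\times\omega)$, i.e. there exists $u\in L^2((0,T)\times\omega)^m$ such that the solution $f$ of $$\partial_t f-B\partial_x^2f+A\partial_xf+Kf=Mu\mathbf 1_\omega\ \text{ in }(0,T)\times\mathbb T,\qquad f(0,\cdot)=f_0,$$ satisfies $f(T,\cdot)=0$. Then there exists $V_0\in\ker(A'^*-\mu)$ such that $M^*\begin{pmatrix}V_0\\0\end{pmatrix}\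neq0$.
   Context: $\mathbb T=\mathbb R/(2\pi\mathbb Z)$. The state is $f:[0,T]\times\mathbb T\to\mathbb R^d$ and the control is $u:[0,T]\times\mathbb T\to\mathbb R^m$. Solutions are mild solutions in $C([0,T];L^2(\mathbb T)^d)$: the operator $-\mathcal L$, where $\mathcal Lf=-B\partial_x^2f+A\partial_xf+Kf$ with domain $H^1(\mathbb T)^{d_{\mathrm h}}\times H^2(\mathbb T)^{d_{\mathrm p}}$, generates a strongly continuous semigroup on $L^2(\mathbb T)^d$. $M^*$ and $A'^*$ denote adjoint matrices; in $\begin{pmatrix}V_0\\0\end{pmatrix}$, $V_0$ has $d_{\mathrm h}$ entries and $0$ has $d_{\mathrm p}$ entries. *)

theory Defs
  imports "HOL-Analysis.Analysis"
begin

section \<open>The space L^2 of the torus\<close>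

text \<open>
  Functions on the torus are represented by functions on the fundamental domain \<open>[0, 2\<pi>)\<close>;
  their values elsewhere are irrelevant.
\<close>

definition circle :: "real measure" where
  "circle = restrict_space lborel {0..<2 * pi}"

lemma space_circle: "space circle = {0..<2 * pi}"
  by (simp add: circle_def space_restrict_space)

lemma finite_measure_circle: "finite_measure circle"
  by (rule finite_measureI) (simp add: circle_def emeasure_restrict_space space_restrict_space)

interpretation circle: finite_measure circle
  by (rule finite_measure_circle)

definition square_integrable :: "(real \<Rightarrow> 'a::euclidean_space) \<Rightarrow> bool" where
  "square_integrable f \<longleftrightarrow>
     f \<in> borel_measurable circle \<and> integrable circle (\<lambda>x. (norm (f x))\<^sup>2)"

lemma square_integrable_measurable [measurable_dest]:
  "square_integrable f \<Longrightarrow> f \<in> borel_measurable circle"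
  by (simp add: square_integrable_def)

lemma square_integrable_zero: "square_integrable (\<lambda>x. 0)"
  by (simp add: square_integrable_def)

lemma square_integrable_add:
  assumes f: "square_integrable f" and g: "square_integrable g"
  shows "square_integrable (\<lambda>x. f x + g x)"
proof -
  have [measurable]: "f \<in> borel_measurable circle" "g \<in> borel_measurable circle"
    using f g by (auto simp: square_integrable_def)
  have le: "(norm (a + b))\<^sup>2 \<le> 2 * (norm a)\<^sup>2 + 2 * (norm b)\<^sup>2" for a b :: 'a
  proof -
    have "(norm (a + b))\<^sup>2 \<le> (norm a + norm b)\<^sup>2"
      by (intro power_mono norm_triangle_ineq) simp
    also have "\<dots> \<le> 2 * (norm a)\<^sup>2 + 2 * (norm b)\<^sup>2"
      using zero_le_power2[of "norm a - norm b"] by (simp add: power2_eq_square algebra_simps)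
    finally show ?thesis .
  qed
  have "integrable circle (\<lambda>x. 2 * (norm (f x))\<^sup>2 + 2 * (norm (g x))\<^sup>2)"
    using f g by (intro Bochner_Integration.integrable_add integrable_mult_right)
      (auto simp: square_integrable_def)
  then have "integrable circle (\<lambda>x. (norm (f x + g x))\<^sup>2)"
    by (rule Bochner_Integration.integrable_bound) (use le in auto)
  then show ?thesis
    by (simp add: square_integrable_def)
qed

lemma square_integrable_linear:
  assumes T: "bounded_linear T" and f: "square_integrable f"
  shows "square_integrable (\<lambda>x. T (f x))"
proof -
  interpret T: bounded_linear T by fact
  have [measurable]: "f \<in> borel_measurable circle" using f by (simp add: square_integrable_def)
  have [measurable]: "T \<in> borel_measurable borel"
    by (intro borel_measurable_continuous_onI T.continuous_on continuous_on_id)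
  obtain C where C: "\<And>x. norm (T x) \<le> norm x * C"
    using T.bounded by blast
  have "integrable circle (\<lambda>x. C\<^sup>2 * (norm (f x))\<^sup>2)"
    using f by (intro integrable_mult_right) (simp add: square_integrable_def)
  then have "integrable circle (\<lambda>x. (norm (T (f x)))\<^sup>2)"
  proof (rule Bochner_Integration.integrable_bound)
    show "AE x in circle. norm ((norm (T (f x)))\<^sup>2) \<le> norm (C\<^sup>2 * (norm (f x))\<^sup>2)"
    proof (rule AE_I2)
      fix x
      have "(norm (T (f x)))\<^sup>2 \<le> (norm (f x) * C)\<^sup>2"
        by (intro power_mono C) simp
      then show "norm ((norm (T (f x)))\<^sup>2) \<le> norm (C\<^sup>2 * (norm (f x))\<^sup>2)"
        by (simp add: power_mult_distrib mult.commute)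
    qed
  qed simp
  then show ?thesis by (simp add: square_integrable_def)
qed

lemmas square_integrable_scaleR = square_integrable_linear[OF bounded_linear_scaleR_right]
lemmas square_integrable_minus = square_integrable_linear[OF bounded_linear_minus[OF bounded_linear_ident]]

lemma square_integrable_diff:
  assumes f: "square_integrable f" and g: "square_integrable g"
  shows "square_integrable (\<lambda>x. f x - g x)"
  using square_integrable_add[OF f square_integrable_minus[OF g]] by simp

lemma integrable_inner:
  assumes f: "square_integrable f" and g: "square_integrable g"
  shows "integrable circle (\<lambda>x. f x \<bullet> g x)"
proof -
  have [measurable]: "f \<in> borel_measurable circle" "g \<in> borel_measurable circle"
    using f g by (auto simp: square_integrable_def)
  have le: "\<bar>a \<bullet> b\<bar> \<le> (norm a)\<^sup>2 + (norm b)\<^sup>2" for a b :: 'a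
  proof -
    have "\<bar>a \<bullet> b\<bar> \<le> norm a * norm b" by (rule Cauchy_Schwarz_ineq2)
    also have "\<dots> \<le> (norm a)\<^sup>2 + (norm b)\<^sup>2"
      using sum_squares_bound[of "norm a" "norm b"] mult_nonneg_nonneg[of "norm a" "norm b"]
      by (simp del: mult_nonneg_nonneg)
    finally show ?thesis .
  qed
  have "integrable circle (\<lambda>x. (norm (f x))\<^sup>2 + (norm (g x))\<^sup>2)"
    using f g by (intro Bochner_Integration.integrable_add) (auto simp: square_integrable_def)
  then show ?thesis
    by (rule Bochner_Integration.integrable_bound) (use le in auto)
qed

lemma square_integrable_bounded:
  assumes [measurable]: "f \<in> borel_measurable circle" and "\<And>x. norm (f x) \<le> C"
  shows "square_integrable f"
proof -
  have "norm ((norm (f x))\<^sup>2) \<le> C\<^sup>2" for x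
    using assms(2)[of x] by (simp add: power_mono)
  then have "integrable circle (\<lambda>x. (norm (f x))\<^sup>2)"
    by (intro circle.integrable_const_bound[where B = "C\<^sup>2"]) auto
  then show ?thesis by (simp add: square_integrable_def)
qed

quotient_type (overloaded) 'a L2 = "real \<Rightarrow> 'a::euclidean_space" / partial:
  "\<lambda>f g. square_integrable f \<and> square_integrable g \<and> (AE x in circle. f x = g x)"
proof (rule part_equivpI)
  show "\<exists>f :: real \<Rightarrow> 'a. square_integrable f \<and> square_integrable f \<and> (AE x in circle. f x = f x)"
    using square_integrable_zero by blast
qed (auto intro!: sympI transpI)

lift_definition L2_class :: "(real \<Rightarrow> 'a::euclidean_space) \<Rightarrow> 'a L2" is
  "\<lambda>f. if square_integrable f then f else (\<lambda>x. 0)"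
  by (auto simp: square_integrable_zero)

lift_definition L2_map :: "('a::euclidean_space \<Rightarrow> 'b::euclidean_space) \<Rightarrow> 'a L2 \<Rightarrow> 'b L2" is
  "\<lambda>T f. if bounded_linear T then (\<lambda>x. T (f x)) else (\<lambda>x. 0)"
  by (auto simp: square_integrable_linear square_integrable_zero)

instantiation L2 :: (euclidean_space) real_inner
begin

lift_definition zero_L2 :: "'a L2" is "\<lambda>x. 0"
  by (simp add: square_integrable_zero)

lift_definition plus_L2 :: "'a L2 \<Rightarrow> 'a L2 \<Rightarrow> 'a L2" is "\<lambda>f g x. f x + g x"
  by (auto simp: square_integrable_add)

lift_definition uminus_L2 :: "'a L2 \<Rightarrow> 'a L2" is "\<lambda>f x. - f x"
  by (auto simp: square_integrable_minus)

lift_definition minus_L2 :: "'a L2 \<Rightarrow> 'a L2 \<Rightarrow> 'a L2" is "\<lambda>f g x. f x - g x"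
  by (auto simp: square_integrable_diff)

lift_definition scaleR_L2 :: "real \<Rightarrow> 'a L2 \<Rightarrow> 'a L2" is "\<lambda>c f x. c *\<^sub>R f x"
  by (auto simp: square_integrable_scaleR)

lift_definition inner_L2 :: "'a L2 \<Rightarrow> 'a L2 \<Rightarrow> real" is
  "\<lambda>f g. \<integral>x. f x \<bullet> g x \<partial>circle"
proof -
  fix f f' g g' :: "real \<Rightarrow> 'a"
  assume "square_integrable f \<and> square_integrable f' \<and> (AE x in circle. f x = f' x)"
    and "square_integrable g \<and> square_integrable g' \<and> (AE x in circle. g x = g' x)"
  then show "(\<integral>x. f x \<bullet> g x \<partial>circle) = (\<integral>x. f' x \<bullet> g' x \<partial>circle)"
    by (intro integral_cong_AE) (auto simp: square_integrable_def)
qed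

definition norm_L2 :: "'a L2 \<Rightarrow> real" where
  "norm_L2 f = sqrt (f \<bullet> f)"

definition dist_L2 :: "'a L2 \<Rightarrow> 'a L2 \<Rightarrow> real" where
  "dist_L2 f g = norm (f - g)"

definition sgn_L2 :: "'a L2 \<Rightarrow> 'a L2" where
  "sgn_L2 f = inverse (norm f) *\<^sub>R f"

definition uniformity_L2 :: "('a L2 \<times> 'a L2) filter" where
  "uniformity_L2 = (INF e\<in>{0<..}. principal {(f, g). dist f g < e})"

definition open_L2 :: "'a L2 set \<Rightarrow> bool" where
  "open_L2 U \<longleftrightarrow> (\<forall>f\<in>U. \<forall>\<^sub>F (f', g) in uniformity. f' = f \<longrightarrow> g \<in> U)"

instance
proof
  fix f g h :: "'a L2" and a b :: real and U :: "'a L2 set"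
  show "f + g + h = f + (g + h)"
    by transfer (auto simp: square_integrable_add add.assoc)
  show "f + g = g + f"
    by transfer (auto simp: square_integrable_add add.commute)
  show "0 + f = f"
    by transfer auto
  show "- f + f = 0"
    by transfer (auto simp: square_integrable_zero)
  show "f - g = f + - g"
    by transfer (auto simp: square_integrable_diff)
  show "a *\<^sub>R (f + g) = a *\<^sub>R f + a *\<^sub>R g"
    by transfer (auto simp: square_integrable_add square_integrable_scaleR scaleR_add_right)
  show "(a + b) *\<^sub>R f = a *\<^sub>R f + b *\<^sub>R f"
    by transfer (auto simp: square_integrable_add square_integrable_scaleR scaleR_add_left)
  show "a *\<^sub>R b *\<^sub>R f = (a * b) *\<^sub>R f"
    by transfer (auto simp: square_integrable_scaleR)
  show "1 *\<^sub>R f = f"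
    by transfer auto
  show "sgn f = inverse (norm f) *\<^sub>R f"
    by (rule sgn_L2_def)
  show "dist f g = norm (f - g)"
    by (rule dist_L2_def)
  show "(uniformity :: ('a L2 \<times> 'a L2) filter) = (INF e\<in>{0<..}. principal {(f, g). dist f g < e})"
    by (rule uniformity_L2_def)
  show "open U \<longleftrightarrow> (\<forall>f\<in>U. \<forall>\<^sub>F (f', g) in uniformity. f' = f \<longrightarrow> g \<in> U)"
    by (rule open_L2_def)
  show "f \<bullet> g = g \<bullet> f"
    by transfer (simp add: inner_commute)
  show "(f + g) \<bullet> h = f \<bullet> h + g \<bullet> h"
    by transfer (simp add: inner_add_left integrable_inner)
  show "a *\<^sub>R f \<bullet> g = a * (f \<bullet> g)"
    by transfer simp
  show "0 \<le> f \<bullet> f"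
    by transfer simp
  show "f \<bullet> f = 0 \<longleftrightarrow> f = 0"
  proof transfer
    fix f :: "real \<Rightarrow> 'a"
    assume "square_integrable f \<and> square_integrable f \<and> (AE x in circle. f x = f x)"
    then have f: "square_integrable f" by simp
    have "(\<integral>x. f x \<bullet> f x \<partial>circle) = 0 \<longleftrightarrow> (AE x in circle. f x \<bullet> f x = 0)"
      by (intro integral_nonneg_eq_0_iff_AE integrable_inner f) simp
    then show "(\<integral>x. f x \<bullet> f x \<partial>circle) = 0 \<longleftrightarrow>
        square_integrable f \<and> square_integrable (\<lambda>x. 0 :: 'a) \<and> (AE x in circle. f x = 0)"
      by (simp add: f square_integrable_zero)
  qed
  show "norm f = sqrt (f \<bullet> f)"
    by (rule norm_L2_def)
qed

end

lemma L2_class_cong: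
  assumes "square_integrable f" "square_integrable g" "AE x in circle. f x = g x"
  shows "L2_class f = L2_class g"
  using assms by transfer auto

lemma L2_class_add:
  assumes "square_integrable f" "square_integrable g"
  shows "L2_class (\<lambda>x. f x + g x) = L2_class f + L2_class g"
  using assms by transfer (auto simp: square_integrable_add)

lemma L2_class_diff:
  assumes "square_integrable f" "square_integrable g"
  shows "L2_class (\<lambda>x. f x - g x) = L2_class f - L2_class g"
  using assms by transfer (auto simp: square_integrable_diff)

lemma L2_class_scaleR:
  assumes "square_integrable f"
  shows "L2_class (\<lambda>x. c *\<^sub>R f x) = c *\<^sub>R L2_class f"
  using assms by transfer (auto simp: square_integrable_scaleR)

lemma L2_class_zero: "L2_class (\<lambda>x. 0) = 0"
  by transfer (auto simp: square_integrable_zero)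

lemma norm_L2_class:
  assumes "square_integrable f"
  shows "(norm (L2_class f))\<^sup>2 = (\<integral>x. (norm (f x))\<^sup>2 \<partial>circle)"
proof -
  have "L2_class f \<bullet> L2_class f = (\<integral>x. f x \<bullet> f x \<partial>circle)"
    using assms by transfer auto
  then show ?thesis by (simp add: power2_norm_eq_inner)
qed

lemma L2_class_cases:
  obtains g where "square_integrable g" "f = L2_class g"
proof -
  have "\<exists>g. square_integrable g \<and> f = L2_class g"
    by transfer auto
  then show ?thesis using that by blast
qed

lemma L2_class_tendsto:
  fixes f :: "real \<Rightarrow> 'a::euclidean_space"
  assumes f: "square_integrable f" and s: "\<And>i. square_integrable (s i)"
    and lim: "\<And>x. x \<in> space circle \<Longrightarrow> (\<lambda>i. s i x) \<longlonglongrightarrow> f x"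
    and bound: "\<And>i x. x \<in> space circle \<Longrightarrow> norm (s i x) \<le> norm (w x)"
    and w: "square_integrable (w :: real \<Rightarrow> 'a)"
  shows "(\<lambda>i. L2_class (s i)) \<longlonglongrightarrow> L2_class f"
proof -
  have [measurable]: "f \<in> borel_measurable circle" "w \<in> borel_measurable circle"
      "\<And>i. s i \<in> borel_measurable circle"
    using f s w by (auto simp: square_integrable_def)
  have fw: "norm (f x) \<le> norm (w x)" if "x \<in> space circle" for x
    by (rule LIMSEQ_le_const2[OF tendsto_norm[OF lim[OF that]]]) (use bound that in auto)
  have "(\<lambda>i. \<integral>x. (norm (s i x - f x))\<^sup>2 \<partial>circle) \<longlonglongrightarrow> (\<integral>x. 0 \<partial>circle)"
  proof (rule integral_dominated_convergence)
    show "integrable circle (\<lambda>x. 4 * (norm (w x))\<^sup>2)"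
      using w by (intro integrable_mult_right) (simp add: square_integrable_def)
    show "AE x in circle. (\<lambda>i. (norm (s i x - f x))\<^sup>2) \<longlonglongrightarrow> 0"
    proof (rule AE_I2)
      fix x assume x: "x \<in> space circle"
      have "(\<lambda>i. (norm (s i x - f x))\<^sup>2) \<longlonglongrightarrow> (norm (f x - f x))\<^sup>2"
        by (intro tendsto_intros lim x)
      then show "(\<lambda>i. (norm (s i x - f x))\<^sup>2) \<longlonglongrightarrow> 0" by simp
    qed
    show "AE x in circle. norm ((norm (s i x - f x))\<^sup>2) \<le> 4 * (norm (w x))\<^sup>2" for i
    proof (rule AE_I2)
      fix x assume x: "x \<in> space circle"
      have "norm (s i x - f x) \<le> norm (s i x) + norm (f x)" by (rule norm_triangle_ineq4)
      also have "\<dots> \<le> 2 * norm (w x)" using bound[OF x, of i] fw[OF x] by simp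
      finally have "(norm (s i x - f x))\<^sup>2 \<le> (2 * norm (w x))\<^sup>2" by (rule power_mono) simp
      then show "norm ((norm (s i x - f x))\<^sup>2) \<le> 4 * (norm (w x))\<^sup>2"
        by (simp add: power_mult_distrib)
    qed
  qed auto
  then have "(\<lambda>i. (norm (L2_class (s i) - L2_class f))\<^sup>2) \<longlonglongrightarrow> 0"
    by (simp add: L2_class_diff[symmetric] f s norm_L2_class square_integrable_diff)
  then have "(\<lambda>i. sqrt ((norm (L2_class (s i) - L2_class f))\<^sup>2)) \<longlonglongrightarrow> sqrt 0"
    by (rule tendsto_real_sqrt)
  then have "(\<lambda>i. norm (L2_class (s i) - L2_class f)) \<longlonglongrightarrow> 0"
    by simp
  then show ?thesis
    by (simp add: tendsto_norm_zero_iff LIM_zero_iff)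
qed

lemma subspace_closure_span: "subspace (closure (span G))" for G :: "'a::real_normed_vector set"
proof (rule subspaceI)
  show "0 \<in> closure (span G)" using closure_subset span_zero by blast
  show "x + y \<in> closure (span G)" if xy: "x \<in> closure (span G)" "y \<in> closure (span G)" for x y
  proof -
    from xy obtain s t where "\<And>n. s n \<in> span G" "s \<longlonglongrightarrow> x" "\<And>n. t n \<in> span G" "t \<longlonglongrightarrow> y"
      unfolding closure_sequential by blast
    then show ?thesis
      unfolding closure_sequential
      by (intro exI[of _ "\<lambda>n. s n + t n"]) (auto intro: span_add tendsto_add)
  qed
  show "c *\<^sub>R x \<in> closure (span G)" if x: "x \<in> closure (span G)" for c x
  proof -
    from x obtain s where "\<And>n. s n \<in> span G" "s \<longlonglongrightarrow> x"
      unfolding closure_sequential by blast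
    then show ?thesis
      unfolding closure_sequential
      by (intro exI[of _ "\<lambda>n. c *\<^sub>R s n"]) (auto intro: span_scale tendsto_scaleR)
  qed
qed

lemma second_countable_span:
  fixes G :: "'a::real_normed_vector set"
  assumes G: "countable G" and dense: "closure (span G) = UNIV"
  shows "\<exists>B::'a set set. countable B \<and> open = generate_topology B"
proof -
  define comb where "comb l = (\<Sum>(q, g)\<leftarrow>l. of_rat q *\<^sub>R g)" for l :: "(rat \<times> 'a) list"
  define D where "D = comb ` lists (UNIV \<times> G)"
  have D: "countable D"
    unfolding D_def using G by (intro countable_image countable_lists countable_SIGMA) auto
  have D_add: "x + y \<in> D" if "x \<in> D" "y \<in> D" for x y
  proof -
    from that obtain k l where "k \<in> lists (UNIV \<times> G)" "x = comb k" "l \<in> lists (UNIV \<times> G)" "y = comb l"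
      by (auto simp: D_def)
    then have "k @ l \<in> lists (UNIV \<times> G)" "x + y = comb (k @ l)"
      by (auto simp: comb_def)
    then show ?thesis unfolding D_def by blast
  qed
  have D_base: "of_rat q *\<^sub>R g \<in> D" if "g \<in> G" for q g
  proof -
    have "[(q, g)] \<in> lists (UNIV \<times> G)" "of_rat q *\<^sub>R g = comb [(q, g)]"
      using that by (auto simp: comb_def)
    then show ?thesis unfolding D_def by blast
  qed
  have "comb [] \<in> D" unfolding D_def by blast
  then have D_zero: "0 \<in> D" by (simp add: comb_def)
  have cl_add: "x + y \<in> closure D" if xy: "x \<in> closure D" "y \<in> closure D" for x y
  proof -
    from xy obtain s t where "\<And>n. s n \<in> D" "s \<longlonglongrightarrow> x" "\<And>n. t n \<in> D" "t \<longlonglongrightarrow> y"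
      unfolding closure_sequential by blast
    then show ?thesis
      unfolding closure_sequential
      by (intro exI[of _ "\<lambda>n. s n + t n"]) (auto intro: D_add tendsto_add)
  qed
  have cl_base: "c *\<^sub>R g \<in> closure D" if g: "g \<in> G" for c g
  proof -
    have "c \<in> closure \<rat>" using Rats_closure_real by simp
    then obtain r where r: "\<And>n. r n \<in> (\<rat> :: real set)" "r \<longlonglongrightarrow> c"
      unfolding closure_sequential by blast
    have "r n *\<^sub>R g \<in> D" for n
      using r(1)[of n] D_base[OF g] by (auto elim: Rats_cases)
    moreover have "(\<lambda>n. r n *\<^sub>R g) \<longlonglongrightarrow> c *\<^sub>R g"
      by (intro tendsto_scaleR r tendsto_const)
    ultimately show ?thesis
      unfolding closure_sequential by (intro exI[of _ "\<lambda>n. r n *\<^sub>R g"]) auto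
  qed
  have "span G \<subseteq> closure D"
  proof
    fix x assume "x \<in> span G"
    then show "x \<in> closure D"
    proof (induction rule: span_induct_alt)
      case base
      then show ?case using D_zero closure_subset by blast
    next
      case (step c g y)
      then show ?case by (intro cl_add cl_base)
    qed
  qed
  then have "closure (span G) \<subseteq> closure D"
    by (rule closure_minimal) simp
  with dense have D_dense: "closure D = UNIV" by auto
  define B where "B = (\<lambda>(d, q). ball d (of_rat q)) ` (D \<times> (UNIV :: rat set))"
  have "countable B"
    unfolding B_def using D by (intro countable_image countable_SIGMA) auto
  moreover have "topological_basis B"
  proof (rule topological_basisI)
    show "open b" if "b \<in> B" for b
      using that by (auto simp: B_def)
    fix U x assume U: "open U" "(x :: 'a) \<in> U"
    then obtain e where e: "e > 0" "ball x e \<subseteq> U"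
      using open_contains_ball by blast
    have "0 < e / 2" using e by simp
    then obtain q where q: "0 < real_of_rat q" "real_of_rat q < e / 2"
      using of_rat_dense by blast
    have "x \<in> closure D" using D_dense by simp
    then obtain d where d: "d \<in> D" "dist d x < of_rat q"
      using q closure_approachable by blast
    have "ball d (of_rat q) \<subseteq> ball x e"
    proof
      fix y assume "y \<in> ball d (of_rat q)"
      then have "dist d y < of_rat q" by simp
      moreover have "dist x y \<le> dist d x + dist d y"
        by (metis dist_commute dist_triangle)
      ultimately show "y \<in> ball x e" using d q by simp
    qed
    moreover have "ball d (of_rat q) \<in> B"
      unfolding B_def using d by auto
    moreover have "x \<in> ball d (of_rat q)"
      using d by simp
    ultimately show "\<exists>b\<in>B. x \<in> b \<and> b \<subseteq> U"
      using e by blast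
  qed
  ultimately show ?thesis
    by (blast intro: topological_basis_imp_subbasis)
qed

instance L2 :: (euclidean_space) second_countable_topology
proof
  obtain B0 :: "real set set" where B0: "countable B0" "topological_basis B0"
    using ex_countable_basis by blast
  define B where "B = Inter ` {F. finite F \<and> F \<subseteq> B0}"
  have B_countable: "countable B"
    unfolding B_def by (intro countable_image countable_Collect_finite_subset B0)
  have B_open: "open b" if "b \<in> B" for b
    using that topological_basis_open[OF B0(2)] by (auto simp: B_def intro!: open_Inter)
  have "b \<in> B" if "b \<in> B0" for b
    unfolding B_def using that by (intro image_eqI[of _ _ "{b}"]) auto
  with B0(2) B_open have "topological_basis B"
    unfolding topological_basis_def by (meson subset_iff)
  then have "(borel :: real measure) = sigma UNIV B"
    by (intro borel_eq_countable_basis B_countable)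
  then have borel_B: "sets (borel :: real measure) = sigma_sets UNIV B"
    by (metis Pow_UNIV sets_measure_of top_greatest)
  have "Int_stable B"
  proof (rule Int_stableI)
    fix a b assume "a \<in> B" "b \<in> B"
    then obtain E F where "finite E" "E \<subseteq> B0" "a = \<Inter>E" "finite F" "F \<subseteq> B0" "b = \<Inter>F"
      by (auto simp: B_def)
    then have "a \<inter> b = \<Inter>(E \<union> F)" "finite (E \<union> F)" "E \<union> F \<subseteq> B0" by auto
    then show "a \<inter> b \<in> B" unfolding B_def by blast
  qed
  have B_Pow: "B \<subseteq> Pow UNIV" by simp
  define u :: "real set \<Rightarrow> 'a \<Rightarrow> 'a L2" where
    "u A c = L2_class (\<lambda>x. indicator A x *\<^sub>R c)" for A c
  have si: "square_integrable (\<lambda>x. indicator A x *\<^sub>R c)" if "A \<in> sets borel" for A and c :: 'a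
  proof (rule square_integrable_bounded)
    show "(\<lambda>x. indicator A x *\<^sub>R c) \<in> borel_measurable circle"
    proof -
      have "(\<lambda>x. indicator A x *\<^sub>R c) \<in> borel_measurable borel"
        using that by (intro borel_measurable_scaleR borel_measurable_indicator borel_measurable_const)
      then show ?thesis
        unfolding circle_def by (intro measurable_restrict_space1) simp
    qed
    show "norm (indicator A x *\<^sub>R c) \<le> norm c" for x
      by (simp add: indicator_def)
  qed
  have UB: "(UNIV :: real set) \<in> sets borel" by simp
  define G where "G = (\<lambda>(A, c). u A c) ` (insert UNIV B \<times> (Basis :: 'a set))"
  have G: "countable G"
    unfolding G_def using B_countable
    by (intro countable_image countable_SIGMA) (auto intro: countable_finite)
  define V where "V = closure (span G)"
  have V: "subspace V" "closed V"
    unfolding V_def by (auto intro: subspace_closure_span)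
  have GV: "G \<subseteq> V"
    unfolding V_def by (meson closure_subset order_trans span_superset)
  have basic: "u A c \<in> V" if "A \<in> sets borel" "c \<in> Basis" for A c
  proof -
    have "A \<in> sigma_sets UNIV B"
      using that(1) unfolding borel_B .
    with \<open>Int_stable B\<close> B_Pow show ?thesis
    proof (induction rule: sigma_sets_induct_disjoint)
      case (basic A)
      then show ?case using GV that by (auto simp: G_def)
    next
      case empty
      show ?case using V(1) by (simp add: u_def L2_class_zero subspace_0)
    next
      case (compl A)
      have A: "A \<in> sets borel" using compl(1) unfolding borel_B .
      have "u (UNIV - A) c = u UNIV c - u A c"
      proof -
        have "(\<lambda>x. indicator (UNIV - A) x *\<^sub>R c) = (\<lambda>x. indicator UNIV x *\<^sub>R c - indicator A x *\<^sub>R c)"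
          by (simp add: fun_eq_iff indicator_def)
        then show ?thesis
          unfolding u_def by (simp only: L2_class_diff[OF si[OF UB, of c] si[OF A, of c]])
      qed
      moreover have "u UNIV c \<in> V" using GV that by (auto simp: G_def)
      ultimately show ?case using compl V(1) by (simp add: subspace_diff)
    next
      case (union A)
      have A: "A i \<in> sets borel" for i using union(2) unfolding borel_B by blast
      have fin: "u (\<Union>i<n. A i) c \<in> V" for n
      proof (induction n)
        case 0
        show ?case using V(1) by (simp add: u_def L2_class_zero subspace_0)
      next
        case (Suc n)
        have disj: "(\<Union>i<n. A i) \<inter> A n = {}"
        proof -
          have "A i \<inter> A n = {}" if "i < n" for i
            using union(1) that unfolding disjoint_family_on_def by simp
          then show ?thesis by blast
        qed
        have U: "(\<Union>i<n. A i) \<in> sets borel" using A by auto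
        have "u (\<Union>i<Suc n. A i) c = u (\<Union>i<n. A i) c + u (A n) c"
        proof -
          have "(\<lambda>x. indicator (\<Union>i<Suc n. A i) x *\<^sub>R c)
              = (\<lambda>x. indicator (\<Union>i<n. A i) x *\<^sub>R c + indicator (A n) x *\<^sub>R c)"
            using disj by (intro ext) (auto simp: indicator_def lessThan_Suc)
          then show ?thesis
            unfolding u_def by (simp only: L2_class_add[OF si[OF U, of c] si[OF A[of n], of c]])
        qed
        then show ?case using Suc union(3) V(1) by (simp add: subspace_add)
      qed
      have "(\<lambda>n. u (\<Union>i<n. A i) c) \<longlonglongrightarrow> u (\<Union>i. A i) c"
        unfolding u_def
      proof (rule L2_class_tendsto[where w = "\<lambda>x. c"])
        show "(\<lambda>n. indicator (\<Union>i<n. A i) x *\<^sub>R c) \<longlonglongrightarrow> indicator (\<Union>i. A i) x *\<^sub>R c" for x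
          by (intro tendsto_scaleR tendsto_const LIMSEQ_indicator_UN)
        show "square_integrable (\<lambda>x. c)" using si[of UNIV c] by simp
        show "square_integrable (\<lambda>x. indicator (\<Union>i. A i) x *\<^sub>R c)"
          using A by (intro si) auto
        show "square_integrable (\<lambda>x. indicator (\<Union>i<n. A i) x *\<^sub>R c)" for n
          using A by (intro si) auto
      qed (simp add: indicator_def)
      then show ?case
        by (rule closed_sequentially[OF V(2) fin])
    qed
  qed
  have ind: "u A c \<in> V" if A: "A \<in> sets borel" for A c
  proof -
    have step: "square_integrable (\<lambda>x. \<Sum>b\<in>S. (c \<bullet> b) *\<^sub>R (indicator A x *\<^sub>R b)) \<and>
        L2_class (\<lambda>x. \<Sum>b\<in>S. (c \<bullet> b) *\<^sub>R (indicator A x *\<^sub>R b)) \<in> V"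
      if "finite S" "S \<subseteq> Basis" for S
      using that
    proof (induction rule: finite_induct)
      case empty
      then show ?case using V(1) by (simp add: L2_class_zero subspace_0 square_integrable_zero)
    next
      case (insert b S)
      have sb: "square_integrable (\<lambda>x. (c \<bullet> b) *\<^sub>R (indicator A x *\<^sub>R b))"
        by (intro square_integrable_scaleR si A)
      moreover have "L2_class (\<lambda>x. (c \<bullet> b) *\<^sub>R (indicator A x *\<^sub>R b)) \<in> V"
        using basic[OF A, of b] insert V(1) si[OF A, of b]
        by (simp only: L2_class_scaleR u_def subspace_scale insert_subset)
      ultimately show ?case
        using insert V(1) by (simp add: square_integrable_add L2_class_add subspace_add)
    qed
    have "(\<Sum>b\<in>Basis. (c \<bullet> b) *\<^sub>R (indicator A x *\<^sub>R b)) = indicator A x *\<^sub>R c" for x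
    proof -
      have "(\<Sum>b\<in>Basis. (c \<bullet> b) *\<^sub>R (indicator A x *\<^sub>R b)) = indicator A x *\<^sub>R (\<Sum>b\<in>Basis. (c \<bullet> b) *\<^sub>R b)"
        by (simp add: scaleR_sum_right mult.commute)
      then show ?thesis by (simp add: euclidean_representation)
    qed
    then show ?thesis using step[of Basis] by (simp add: u_def)
  qed
  have simple: "square_integrable s \<and> L2_class s \<in> V" if s: "simple_function circle s" for s :: "real \<Rightarrow> 'a"
  proof -
    define R where "R = s ` space circle"
    define A where "A y = s -` {y} \<inter> space circle" for y
    have R: "finite R" using s by (simp add: R_def simple_function_def)
    have A: "A y \<in> sets borel" for y
    proof -
      have "A y \<in> sets circle" unfolding A_def
        by (rule measurable_sets[OF borel_measurable_simple_function[OF s]]) simp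
      then show ?thesis by (auto simp: circle_def sets_restrict_space)
    qed
    have step: "square_integrable (\<lambda>x. \<Sum>y\<in>F. indicator (A y) x *\<^sub>R y) \<and>
        L2_class (\<lambda>x. \<Sum>y\<in>F. indicator (A y) x *\<^sub>R y) \<in> V" if "finite F" for F
      using that
    proof (induction rule: finite_induct)
      case empty
      then show ?case using V(1) by (simp add: L2_class_zero subspace_0 square_integrable_zero)
    next
      case (insert y F)
      have "u (A y) y \<in> V" by (rule ind[OF A])
      with insert show ?case
        using si[OF A[of y], of y] V(1)
        by (simp only: sum.insert square_integrable_add L2_class_add subspace_add u_def simp_thms)
    qed
    have eq: "s x = (\<Sum>y\<in>R. indicator (A y) x *\<^sub>R y)" if x: "x \<in> space circle" for x
    proof -
      have "(\<Sum>y\<in>R. indicator (A y) x *\<^sub>R y) = (\<Sum>y\<in>R. if y = s x then y else 0)"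
        using x by (intro sum.cong) (auto simp: A_def indicator_def)
      also have "\<dots> = s x"
        using R x by (simp add: R_def)
      finally show ?thesis by simp
    qed
    have s': "square_integrable s"
    proof -
      have "integrable circle (\<lambda>x. (norm (s x))\<^sup>2)
          \<longleftrightarrow> integrable circle (\<lambda>x. (norm (\<Sum>y\<in>R. indicator (A y) x *\<^sub>R y))\<^sup>2)"
        by (intro Bochner_Integration.integrable_cong) (auto simp: eq)
      then show ?thesis
        using step[OF R] borel_measurable_simple_function[OF s] by (simp add: square_integrable_def)
    qed
    have "L2_class s = L2_class (\<lambda>x. \<Sum>y\<in>R. indicator (A y) x *\<^sub>R y)"
      using step[OF R] by (intro L2_class_cong s' AE_I2) (auto simp: eq)
    then show ?thesis using step[OF R] s' by simp
  qed
  have "f \<in> V" for f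
  proof -
    obtain g where g: "square_integrable g" "f = L2_class g" by (rule L2_class_cases)
    have "g \<in> borel_measurable circle" using g by (simp add: square_integrable_def)
    from borel_measurable_implies_sequence_metric[OF this, of 0] obtain s where
      s: "\<And>i. simple_function circle (s i)" "\<And>x. x \<in> space circle \<Longrightarrow> (\<lambda>i. s i x) \<longlonglongrightarrow> g x"
        "\<And>i x. x \<in> space circle \<Longrightarrow> norm (s i x) \<le> 2 * norm (g x)"
      by simp metis
    have "(\<lambda>i. L2_class (s i)) \<longlonglongrightarrow> f"
      unfolding g(2)
    proof (rule L2_class_tendsto[where w = "\<lambda>x. 2 *\<^sub>R g x"])
      show "square_integrable (\<lambda>x. 2 *\<^sub>R g x)" by (intro square_integrable_scaleR g)
    qed (use g s simple in auto)
    then show ?thesis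
      by (rule closed_sequentially[OF V(2) simple[OF s(1), THEN conjunct2]])
  qed
  then have "closure (span G) = UNIV" by (auto simp: V_def)
  with G show "\<exists>B::'a L2 set set. countable B \<and> open = generate_topology B"
    by (rule second_countable_span)
qed

lemma square_integrable_rep_L2: "square_integrable (rep_L2 f)"
  using Quotient_rep_reflp[OF Quotient_L2, of f] by simp

lemma L2_class_rep_L2: "L2_class (rep_L2 f) = f"
proof -
  have "L2_class (rep_L2 f) = abs_L2 (rep_L2 f)"
    by (simp add: L2_class.abs_eq L2_class_def square_integrable_rep_L2)
  then show ?thesis
    by (simp add: Quotient_abs_rep[OF Quotient_L2])
qed


section \<open>Matrices\<close>

definition complex_matrix :: "real^'n^'m \<Rightarrow> complex^'n^'m" where
  "complex_matrix A = (\<chi> i j. complex_of_real (A $ i $ j))"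

definition spectrum :: "'a::field^'n^'n \<Rightarrow> 'a set" where
  "spectrum A = {z. \<exists>v. v \<noteq> 0 \<and> A *v v = z *s v}"

definition diagonalizable :: "'a::field^'n^'n \<Rightarrow> bool" where
  "diagonalizable A \<longleftrightarrow>
     (\<exists>P \<Delta> :: 'a^'n^'n. invertible P \<and> (\<forall>i j. i \<noteq> j \<longrightarrow> \<Delta> $ i $ j = 0) \<and> A = P ** \<Delta> ** matrix_inv P)"

definition block_matrix ::
  "real^'h^'h \<Rightarrow> real^'p^'h \<Rightarrow> real^'h^'p \<Rightarrow> real^'p^'p \<Rightarrow> real^('h + 'p)^('h + 'p)" where
  "block_matrix P Q R S = (\<chi> i j.
     case i of
       Inl a \<Rightarrow> (case j of Inl b \<Rightarrow> P $ a $ b | Inr b \<Rightarrow> Q $ a $ b)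
     | Inr a \<Rightarrow> (case j of Inl b \<Rightarrow> R $ a $ b | Inr b \<Rightarrow> S $ a $ b))"

definition pad_zero :: "real^'h::finite \<Rightarrow> real^('h + 'p::finite)" where
  "pad_zero v = (\<chi> i. case i of Inl a \<Rightarrow> v $ a | Inr b \<Rightarrow> 0)"


section \<open>Fourier coefficients and weak derivatives on the torus\<close>

definition fourier_coeff :: "(real^'n) L2 \<Rightarrow> int \<Rightarrow> complex^'n" where
  "fourier_coeff f n = (\<chi> j.
     (\<integral>x. complex_of_real (rep_L2 f x $ j) * cis (- (of_int n * x)) \<partial>circle) / of_real (2 * pi))"

definition periodic_smooth :: "(real \<Rightarrow> real) \<Rightarrow> bool" where
  "periodic_smooth \<phi> \<longleftrightarrow>
     (\<forall>x. \<phi> (x + 2 * pi) = \<phi> x) \<and> (\<forall>k x. (deriv ^^ k) \<phi> differentiable (at x))"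

definition has_weak_deriv :: "(real \<Rightarrow> real) \<Rightarrow> (real \<Rightarrow> real) \<Rightarrow> bool" where
  "has_weak_deriv f g \<longleftrightarrow> (\<forall>\<phi>. periodic_smooth \<phi> \<longrightarrow>
     (\<integral>x. f x * deriv \<phi> x \<partial>circle) = - (\<integral>x. g x * \<phi> x \<partial>circle))"

definition component :: "(real^'n) L2 \<Rightarrow> 'n \<Rightarrow> real \<Rightarrow> real" where
  "component f j x = rep_L2 f x $ j"


section \<open>The parabolic-transport system\<close>

text \<open>
  The graph of \<open>L f = - B f'' + A f' + K f\<close> with domain \<open>H\<^sup>1\<close> in the hyperbolic components
  (index \<open>Inl\<close>) and \<open>H\<^sup>2\<close> in the parabolic ones (index \<open>Inr\<close>): \<open>f1\<close> is the derivative of \<open>f\<close>,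
  and the parabolic part of \<open>f2\<close> is the second derivative of the parabolic part of \<open>f\<close>.
  The hyperbolic part of \<open>f\<close> has no second derivative in \<open>L\<^sup>2\<close> in general. It does not enter
  \<open>B f''\<close>, because the corresponding columns of \<open>B\<close> vanish; in \<open>f2\<close> it is replaced by 0.
\<close>

definition pt_graph ::
  "real^('h::finite + 'p::finite)^('h + 'p) \<Rightarrow> real^('h + 'p)^('h + 'p) \<Rightarrow> real^('h + 'p)^('h + 'p)
   \<Rightarrow> ((real^('h + 'p)) L2 \<times> (real^('h + 'p)) L2) set" where
  "pt_graph B A K =
     {(f, - L2_map ((*v) B) f2 + L2_map ((*v) A) f1 + L2_map ((*v) K) f) | f f1 f2.
        (\<forall>i. has_weak_deriv (component f i) (component f1 i)) \<and>
        (\<forall>b. has_weak_deriv (component f1 (Inr b)) (component f2 (Inr b))) \<and>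
        (\<forall>a. AE x in circle. component f2 (Inl a) x = 0)}"

definition C0_semigroup :: "(real \<Rightarrow> 'a::real_normed_vector \<Rightarrow> 'a) \<Rightarrow> bool" where
  "C0_semigroup S \<longleftrightarrow>
     (\<forall>t\<ge>0. bounded_linear (S t)) \<and> S 0 = id \<and>
     (\<forall>s\<ge>0. \<forall>t\<ge>0. S (s + t) = S s \<circ> S t) \<and>
     (\<forall>f. ((\<lambda>t. S t f) \<longlongrightarrow> f) (at_right 0))"

definition generator_graph :: "(real \<Rightarrow> 'a::real_normed_vector \<Rightarrow> 'a) \<Rightarrow> ('a \<times> 'a) set" where
  "generator_graph S = {(f, g). ((\<lambda>h. (S h f - f) /\<^sub>R h) \<longlongrightarrow> g) (at_right 0)}"

text \<open>
  A generator is closed. The operator \<open>- L\<close> is closed on \<open>H\<^sup>1 \<times> H\<^sup>2\<close> when the hyperbolic block of \<open>A\<close>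
  is invertible, and then the closure below is the graph of \<open>- L\<close> itself. It need not be closed
  otherwise (e.g. if \<open>A = K = 0\<close>), and the generator is then its closure.
\<close>

definition pt_semigroup ::
  "real^('h::finite + 'p::finite)^('h + 'p) \<Rightarrow> real^('h + 'p)^('h + 'p) \<Rightarrow> real^('h + 'p)^('h + 'p)
   \<Rightarrow> (real \<Rightarrow> (real^('h + 'p)) L2 \<Rightarrow> (real^('h + 'p)) L2) \<Rightarrow> bool" where
  "pt_semigroup B A K S \<longleftrightarrow>
     C0_semigroup S \<and> generator_graph S = closure {(f, - g) | f g. (f, g) \<in> pt_graph B A K}"

text \<open>
  Subsets of the torus are represented by their preimages in the real line, and the open sets of
  the torus are those with an open preimage.
\<close>

definition open_torus :: "real set \<Rightarrow> bool" where
  "open_torus \<omega> \<longleftrightarrow> open \<omega> \<and> (\<forall>x. x + 2 * pi \<in> \<omega> \<longleftrightarrow> x \<in> \<omega>)"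

definition L2_control :: "real \<Rightarrow> real set \<Rightarrow> (real \<Rightarrow> real \<Rightarrow> real^'m) \<Rightarrow> bool" where
  "L2_control T \<omega> u \<longleftrightarrow>
     (let Q = {0<..<T} \<times> (\<omega> \<inter> {0..<2 * pi}) in
        set_borel_measurable lborel Q (\<lambda>(t, x). u t x) \<and>
        set_integrable lborel Q (\<lambda>(t, x). (norm (u t x))\<^sup>2))"

text \<open>
  For almost every \<open>s\<close> the source term \<open>M u(s) 1\<^sub>\<omega>\<close> is square integrable; for the remaining \<open>s\<close>,
  \<^const>\<open>L2_class\<close> gives 0.
\<close>

definition mild_solution ::
  "real^('h::finite + 'p::finite)^('h + 'p) \<Rightarrow> real^('h + 'p)^('h + 'p) \<Rightarrow> real^('h + 'p)^('h + 'p)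
   \<Rightarrow> real^'m^('h + 'p) \<Rightarrow> real set \<Rightarrow> real \<Rightarrow> (real^('h + 'p)) L2 \<Rightarrow> (real \<Rightarrow> real \<Rightarrow> real^'m)
   \<Rightarrow> (real \<Rightarrow> (real^('h + 'p)) L2) \<Rightarrow> bool" where
  "mild_solution B A K M \<omega> T f0 u f \<longleftrightarrow>
     continuous_on {0..T} f \<and>
     (\<exists>S. pt_semigroup B A K S \<and>
        (\<forall>t\<in>{0..T}. has_bochner_integral (restrict_space lborel {0<..<t})
           (\<lambda>s. S (t - s) (L2_class (\<lambda>x. indicator \<omega> x *\<^sub>R (M *v u s x))))
           (f t - S t f0)))"

definition steerable_to_zero ::
  "real^('h::finite + 'p::finite)^('h + 'p) \<Rightarrow> real^('h + 'p)^('h + 'p) \<Rightarrow> real^('h + 'p)^('h + 'p)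
   \<Rightarrow> real^'m^('h + 'p) \<Rightarrow> real set \<Rightarrow> real \<Rightarrow> (real^('h + 'p)) L2 \<Rightarrow> bool" where
  "steerable_to_zero B A K M \<omega> T f0 \<longleftrightarrow>
     (\<exists>u f. L2_control T \<omega> u \<and> mild_solution B A K M \<omega> T f0 u f \<and> f T = 0)"

end

theory Submission
  imports Defs "HOL-Computational_Algebra.Fundamental_Theorem_Algebra"
begin

text \<open>
  On the mode \<open>e\<^sup>i\<^sup>n\<^sup>x\<close> the operator \<open>L\<close> acts as the matrix
  \<open>L\<^sub>n = n\<^sup>2 B + i n A + K\<close> (\<open>symbol\<close>), and for large \<open>n\<close> this matrix has nearly a left eigenvector
  that lives in the hyperbolic components and whose decay rate does not grow with \<open>n\<close>. If
  \<open>M\<^sup>*\<close> vanishes on all of \<open>ker (A'\<^sup>* - \<mu>)\<close>, the control hardly sees this direction, and a state that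
  puts enough weight on it at infinitely many frequencies cannot be brought to rest.

  In more detail, there are rows \<open>W0, W1, W2\<close> and a number \<open>l\<close> such that
  \<open>w\<^sub>n = W0 + W1 / n + W2 / n\<^sup>2\<close> satisfies \<open>w\<^sub>n L\<^sub>n = \<sigma>\<^sub>n w\<^sub>n + O(1 / n)\<close> with \<open>\<sigma>\<^sub>n = i n \<mu> + l\<close>
  (\<open>formal_hyperbolic_eigenvector\<close>, \<open>expansion_symbol\<close>). The leading row is \<open>W0 = (v, 0)\<close> with
  \<open>v A' = \<mu> v\<close>, where \<open>v\<close> has to be chosen inside the eigenspace as an eigenvector of the map that the
  lower order terms induce there; this is why \<open>M\<^sup>*\<close> is required to vanish on the whole eigenspace.

  Pairing with \<open>w\<^sub>n\<close> turns the free evolution into multiplication by \<open>e\<^sup>-\<^sup>\<sigma>\<^sup>t\<close>, where \<open>\<sigma> = \<sigma>\<^sub>n\<close>, up to an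
  error \<open>O(1 / n)\<close> (\<open>mode_approx_eigenvector\<close>). The error is controlled by the bound of the semigroup
  on \<open>[0, T]\<close>, which is the same for all frequencies, so no spectral estimate on \<open>L\<^sub>n\<close> enters. That bound
  comes from the uniform boundedness principle, hence from the completeness of \<open>L\<^sup>2\<close>.

  Now let \<open>f\<^sub>0\<close> be steerable to 0. Since \<open>W0 M = 0\<close>, the control contributes \<open>O(1 / n)\<close> to the pairing of
  \<open>w\<^sub>n\<close> with the final state, while \<open>f\<^sub>0\<close> contributes \<open>e\<^sup>-\<^sup>\<sigma>\<^sup>T w\<^sub>n\<close> times its \<open>n\<close>-th Fourier coefficient, and
  \<open>e\<^sup>-\<^sup>\<sigma>\<^sup>T\<close> has a modulus independent of \<open>n\<close>. So \<open>w\<^sub>n\<close> applied to that coefficient is \<open>O(1 / n)\<close>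
  (\<open>steerable_mode_bound\<close>). The lacunary series \<open>f\<^sub>0 = \<Sum>\<^sub>k 2\<^sup>-\<^sup>k Re (e\<^sup>i\<^sup>\<nu>\<^sup>x z)\<close>, where \<open>z\<close> is the complex
  conjugate of \<open>W0\<close> and the frequency of the \<open>k\<close>-th term is \<open>\<nu> = (N + 1) 4\<^sup>k\<close>, violates this estimate
  (\<open>lacunary_series_exists\<close>): its coefficients decay like the inverse square root of the frequency.
\<close>

section \<open>Completeness of L^2 of the circle\<close>

lemma inner_L2_class:
  assumes "square_integrable f" "square_integrable g"
  shows "L2_class f \<bullet> L2_class g = (\<integral>x. f x \<bullet> g x \<partial>circle)"
  using assms by transfer auto

lemma square_integrable_const: "square_integrable (\<lambda>x. c)"
  by (rule square_integrable_bounded[where C = "norm c"]) auto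

lemma square_integrable_imp_integrable_norm:
  assumes f: "square_integrable f"
  shows "integrable circle (\<lambda>x. norm (f x))"
proof (rule Bochner_Integration.integrable_bound)
  show "integrable circle (\<lambda>x. (norm (f x))\<^sup>2 + 1)"
    using f by (intro Bochner_Integration.integrable_add) (auto simp: square_integrable_def)
  show "AE x in circle. norm (norm (f x)) \<le> norm ((norm (f x))\<^sup>2 + 1)"
  proof (rule AE_I2)
    fix x
    have "2 * norm (f x) \<le> (norm (f x))\<^sup>2 + 1"
      using zero_le_power2[of "norm (f x) - 1"] by (simp add: power2_diff)
    then show "norm (norm (f x)) \<le> norm ((norm (f x))\<^sup>2 + 1)"
      using norm_ge_zero[of "f x"] unfolding real_norm_def abs_norm_cancel by linarith
  qed
qed (use f in \<open>auto simp: square_integrable_def\<close>)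

text \<open>
  Fast convergence in \<open>L\<^sup>2\<close> has to be converted into convergence almost everywhere; the \<open>L\<^sup>1\<close> norm,
  which commutes with infinite sums of nonnegative functions, is the intermediary.
\<close>

lemma integral_norm_le_norm_L2:
  assumes f: "square_integrable f"
  shows "(\<integral>x. norm (f x) \<partial>circle) \<le> sqrt (2 * pi) * norm (L2_class f)"
proof -
  define F where "F = L2_class (\<lambda>x. norm (f x))"
  define G where "G = L2_class (\<lambda>x. 1 :: real)"
  have n: "square_integrable (\<lambda>x. norm (f x))"
    using f by (auto simp: square_integrable_def)
  have "norm F = norm (L2_class f)"
    using norm_L2_class[OF n] norm_L2_class[OF f]
    by (simp add: F_def power2_eq_iff_nonneg[OF norm_ge_zero norm_ge_zero, symmetric])
  moreover have "norm G = sqrt (2 * pi)"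
  proof -
    have "(norm G)\<^sup>2 = 2 * pi"
      unfolding G_def norm_L2_class[OF square_integrable_const]
      by (simp add: space_circle circle_def measure_restrict_space)
    then show ?thesis by (metis norm_ge_zero real_sqrt_unique)
  qed
  moreover have "(\<integral>x. norm (f x) \<partial>circle) = F \<bullet> G"
    unfolding F_def G_def by (simp add: inner_L2_class n square_integrable_const)
  ultimately show ?thesis
    using norm_cauchy_schwarz[of F G] by (simp add: mult.commute)
qed

text \<open>By Fatou's lemma, the distance to a fixed term does not increase in the limit.\<close>

lemma square_integrable_AE_limit:
  fixes g :: "nat \<Rightarrow> real \<Rightarrow> 'a::euclidean_space"
  assumes g: "\<And>k. square_integrable (g k)" and [measurable]: "G \<in> borel_measurable circle"
    and lim: "AE x in circle. (\<lambda>m. g m x) \<longlonglongrightarrow> G x"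
    and bound: "\<And>m. m \<ge> k \<Longrightarrow> norm (L2_class (g m) - L2_class (g k)) \<le> e"
  shows "square_integrable G" "norm (L2_class G - L2_class (g k)) \<le> e"
proof -
  have [measurable]: "g m \<in> borel_measurable circle" for m
    using g[of m] by (simp add: square_integrable_def)
  have e: "0 \<le> e" using bound[of k] by simp
  have "(\<integral>\<^sup>+x. ennreal ((norm (G x - g k x))\<^sup>2) \<partial>circle)
      = (\<integral>\<^sup>+x. liminf (\<lambda>m. ennreal ((norm (g m x - g k x))\<^sup>2)) \<partial>circle)"
  proof (rule nn_integral_cong_AE, use lim in eventually_elim)
    case (elim x)
    then have "(\<lambda>m. ennreal ((norm (g m x - g k x))\<^sup>2)) \<longlonglongrightarrow> ennreal ((norm (G x - g k x))\<^sup>2)"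
      by (intro tendsto_intros)
    then show ?case by (rule lim_imp_Liminf[OF trivial_limit_sequentially, symmetric])
  qed
  also have "\<dots> \<le> liminf (\<lambda>m. \<integral>\<^sup>+x. ennreal ((norm (g m x - g k x))\<^sup>2) \<partial>circle)"
    by (rule nn_integral_liminf) simp
  also have "\<dots> \<le> ennreal (e\<^sup>2)"
  proof (rule order_trans[OF Liminf_le_Limsup Limsup_bounded])
    show "\<forall>\<^sub>F m in sequentially. (\<integral>\<^sup>+x. ennreal ((norm (g m x - g k x))\<^sup>2) \<partial>circle) \<le> ennreal (e\<^sup>2)"
      using eventually_ge_at_top[of k]
    proof eventually_elim
      case (elim m)
      have d: "square_integrable (\<lambda>x. g m x - g k x)" by (intro square_integrable_diff g)
      have "(\<integral>\<^sup>+x. ennreal ((norm (g m x - g k x))\<^sup>2) \<partial>circle) = ennreal ((norm (L2_class (g m) - L2_class (g k)))\<^sup>2)"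
        using d unfolding L2_class_diff[OF g g, symmetric] norm_L2_class[OF d]
        by (intro nn_integral_eq_integral) (auto simp: square_integrable_def)
      also have "\<dots> \<le> ennreal (e\<^sup>2)"
        by (intro ennreal_leI power_mono bound elim) simp
      finally show ?case .
    qed
  qed simp
  finally have le: "(\<integral>\<^sup>+x. ennreal ((norm (G x - g k x))\<^sup>2) \<partial>circle) \<le> ennreal (e\<^sup>2)" .
  then have int: "integrable circle (\<lambda>x. (norm (G x - g k x))\<^sup>2)"
    by (intro integrableI_bounded) (auto intro: le_less_trans)
  then have d: "square_integrable (\<lambda>x. G x - g k x)"
    by (simp add: square_integrable_def)
  show G: "square_integrable G"
    using square_integrable_add[OF d g[of k]] by simp
  have "ennreal ((norm (L2_class G - L2_class (g k)))\<^sup>2) \<le> ennreal (e\<^sup>2)"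
    using le unfolding L2_class_diff[OF G g, symmetric] norm_L2_class[OF d]
    by (subst (asm) nn_integral_eq_integral[OF int]) auto
  then show "norm (L2_class G - L2_class (g k)) \<le> e"
    using e by (simp add: ennreal_le_iff power2_le_iff_abs_le)
qed

text \<open>
  The Riesz--Fischer theorem. A subsequence with consecutive distances at most \<open>2\<^sup>-\<^sup>k\<close> has increments
  that are summable in \<open>L\<^sup>1\<close>, so it converges almost everywhere.
\<close>

instance L2 :: (euclidean_space) banach
proof
  fix X :: "nat \<Rightarrow> 'a L2"
  assume X: "Cauchy X"
  have "\<forall>k. \<exists>N. \<forall>m\<ge>N. \<forall>n\<ge>N. norm (X m - X n) < (1 / 2) ^ k"
    using X unfolding Cauchy_iff by (metis half_gt_zero_iff zero_less_one zero_less_power)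
  then obtain N where N: "\<And>k m n. m \<ge> N k \<Longrightarrow> n \<ge> N k \<Longrightarrow> norm (X m - X n) < (1 / 2) ^ k"
    by metis
  (* Partial sums make the indices increasing while keeping them above the required bounds. *)
  define r where "r k = (\<Sum>i\<le>k. N i) + k" for k
  have r: "strict_mono r" by (rule strict_mono_Suc_iff[THEN iffD2]) (simp add: r_def)
  have rN: "r m \<ge> N k" if "m \<ge> k" for m k
  proof -
    have "N k \<le> (\<Sum>i\<le>m. N i)" using that by (intro member_le_sum) auto
    then show ?thesis by (simp add: r_def)
  qed
  define g where "g k = rep_L2 (X (r k))" for k
  have g: "square_integrable (g k)" for k
    unfolding g_def by (rule square_integrable_rep_L2)
  have gX: "L2_class (g k) = X (r k)" for k
    unfolding g_def by (rule L2_class_rep_L2)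
  have [measurable]: "g m \<in> borel_measurable circle" for m
    using g[of m] by (simp add: square_integrable_def)
  have dist: "norm (L2_class (g m) - L2_class (g k)) \<le> (1 / 2) ^ k" if "m \<ge> k" for m k
    unfolding gX using N[of k "r m" "r k"] rN[OF that] rN[of k k] by simp
  define h where "h k x = norm (g (Suc k) x - g k x)" for k x
  have [measurable]: "h k \<in> borel_measurable circle" for k
    unfolding h_def by measurable
  have "(\<integral>\<^sup>+x. (\<Sum>k. ennreal (h k x)) \<partial>circle) = (\<Sum>k. \<integral>\<^sup>+x. ennreal (h k x) \<partial>circle)"
    by (intro nn_integral_suminf) simp
  also have "\<dots> \<le> (\<Sum>k. ennreal (sqrt (2 * pi) * (1 / 2) ^ k))"
  proof (intro suminf_le allI summableI)
    fix k
    have d: "square_integrable (\<lambda>x. g (Suc k) x - g k x)" by (intro square_integrable_diff g)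
    have "(\<integral>\<^sup>+x. ennreal (h k x) \<partial>circle) = ennreal (\<integral>x. h k x \<partial>circle)"
      unfolding h_def by (intro nn_integral_eq_integral square_integrable_imp_integrable_norm d) auto
    also have "(\<integral>x. h k x \<partial>circle) \<le> sqrt (2 * pi) * norm (L2_class (g (Suc k)) - L2_class (g k))"
      unfolding h_def using integral_norm_le_norm_L2[OF d] by (simp add: L2_class_diff g)
    also have "\<dots> \<le> sqrt (2 * pi) * (1 / 2) ^ k"
      by (intro mult_left_mono dist) auto
    finally show "(\<integral>\<^sup>+x. ennreal (h k x) \<partial>circle) \<le> ennreal (sqrt (2 * pi) * (1 / 2) ^ k)"
      by (simp add: ennreal_leI)
  qed
  also have "\<dots> = ennreal (\<Sum>k. sqrt (2 * pi) * (1 / 2) ^ k)"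
    by (intro suminf_ennreal2 summable_mult summable_geometric) auto
  also have "\<dots> < \<infinity>" by simp
  finally have "AE x in circle. (\<Sum>k. ennreal (h k x)) \<noteq> \<infinity>"
    by (intro nn_integral_noteq_infinite) auto
  then have lim: "AE x in circle. (\<lambda>m. g m x) \<longlonglongrightarrow> lim (\<lambda>m. g m x)"
  proof eventually_elim
    case (elim x)
    have "summable (\<lambda>k. h k x)"
      by (rule summable_suminf_not_top) (use elim in \<open>auto simp: h_def\<close>)
    then have "summable (\<lambda>k. g (Suc k) x - g k x)"
      unfolding h_def by (rule summable_norm_cancel)
    then have "convergent (\<lambda>n. \<Sum>k<n. g (Suc k) x - g k x)"
      by (simp add: summable_iff_convergent)
    then have "convergent (\<lambda>n. g n x - g 0 x)"
      using sum_lessThan_telescope[of "\<lambda>k. g k x"] by simp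
    then have "convergent (\<lambda>n. g n x)"
      using convergent_add[OF _ convergent_const[of "g 0 x"]] by fastforce
    then show ?case by (simp add: convergent_LIMSEQ_iff)
  qed
  define G where "G x = lim (\<lambda>m. g m x)" for x
  have G: "norm (X (r k) - L2_class G) \<le> (1 / 2) ^ k" for k
    using square_integrable_AE_limit(2)[OF g _ lim dist, of k]
    by (simp add: G_def[abs_def] gX norm_minus_commute)
  have "(\<lambda>k. X (r k) - L2_class G) \<longlonglongrightarrow> 0"
    by (rule Lim_null_comparison[OF always_eventually LIMSEQ_power_zero[of "1 / 2 :: real"]])
      (use G in auto)
  then have "(X \<circ> r) \<longlonglongrightarrow> L2_class G"
    by (simp add: LIM_zero_iff o_def)
  then have "X \<longlonglongrightarrow> L2_class G"
    by (rule Cauchy_converges_subseq[OF X r])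
  then show "convergent X" by (rule convergentI)
qed

section \<open>Strongly continuous semigroups\<close>

text \<open>
  The sets on which all \<open>T k\<close> are bounded by \<open>n\<close> are closed and cover the space, so by Baire's theorem
  one of them contains a ball; translating the ball to the origin gives the bound.
\<close>

lemma uniform_boundedness:
  fixes T :: "nat \<Rightarrow> 'a::banach \<Rightarrow> 'b::real_normed_vector"
  assumes T: "\<And>k. bounded_linear (T k)" and pt: "\<And>x. \<exists>C. \<forall>k. norm (T k x) \<le> C"
  shows "\<exists>C. \<forall>k x. norm (T k x) \<le> C * norm x"
proof -
  define F where "F n = {x. \<forall>k. norm (T k x) \<le> real n}" for n
  have cont: "continuous_on UNIV (T k)" for k
    by (rule linear_continuous_on[OF T])
  have closed: "closed (F n)" for n
    unfolding F_def Collect_all_eq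
    by (intro closed_INT ballI closed_Collect_le continuous_on_norm cont continuous_on_const)
  have cover: "(\<Union>n. F n) = UNIV"
  proof -
    have "\<exists>n. x \<in> F n" for x
    proof -
      obtain C where C: "\<And>k. norm (T k x) \<le> C" using pt by blast
      obtain n where "C \<le> real n" using real_arch_simple by blast
      then have "x \<in> F n" unfolding F_def using C order_trans by blast
      then show ?thesis ..
    qed
    then show ?thesis by blast
  qed
  have "\<exists>n. interior (F n) \<noteq> {}"
  proof (rule ccontr)
    assume "\<not> ?thesis"
    then have "euclidean interior_of \<Union>(range F) = {}"
      by (intro Baire_category_alt disjI1 completely_metrizable_space_euclidean)
        (auto simp: closed)
    then show False using cover by simp
  qed
  then obtain n x0 e where e: "e > 0" "cball x0 e \<subseteq> F n"
    using open_contains_cball[of "interior (F n)" for n] interior_subset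
    by (metis all_not_in_conv open_interior subset_trans)
  have "norm (T k x) \<le> (2 * real n / e) * norm x" for k x
  proof (cases "x = 0")
    case True
    then show ?thesis using T[of k] by (simp add: linear_simps)
  next
    case False
    define y where "y = (e / norm x) *\<^sub>R x"
    have "norm y = e" using False e by (simp add: y_def)
    then have "x0 \<in> F n" "x0 + y \<in> F n" using e by (auto simp: dist_norm subset_iff)
    then have "norm (T k x0) \<le> n" "norm (T k (x0 + y)) \<le> n" by (auto simp: F_def)
    moreover have "T k y = T k (x0 + y) - T k x0"
      using T[of k] by (simp add: linear_simps)
    ultimately have "norm (T k y) \<le> 2 * n"
      using norm_triangle_ineq4[of "T k (x0 + y)" "T k x0"] by simp
    moreover have "norm (T k y) = e / norm x * norm (T k x)"
      using T[of k] e by (simp add: y_def linear_simps)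
    ultimately show ?thesis using e False by (simp add: field_simps)
  qed
  then show ?thesis by blast
qed

text \<open>
  If the operators were unbounded near \<open>t = 0\<close>, there would be times \<open>t m\<close> tending to 0 along which
  \<open>S (t m)\<close> is unbounded, although it converges pointwise. Powers of \<open>S t\<close> for small \<open>t\<close> reach all of
  \<open>[0, T]\<close>.
\<close>

lemma C0_semigroup_locally_bounded:
  fixes S :: "real \<Rightarrow> 'a::banach \<Rightarrow> 'a"
  assumes S: "C0_semigroup S"
  shows "\<exists>C\<ge>0. \<forall>t\<in>{0..T}. \<forall>x. norm (S t x) \<le> C * norm x"
proof -
  have lin: "\<And>t. t \<ge> 0 \<Longrightarrow> bounded_linear (S t)" and zero: "S 0 = id"
    and add: "\<And>s t. s \<ge> 0 \<Longrightarrow> t \<ge> 0 \<Longrightarrow> S (s + t) = S s \<circ> S t"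
    and cont: "\<And>f. ((\<lambda>t. S t f) \<longlongrightarrow> f) (at_right 0)"
    using S unfolding C0_semigroup_def by blast+
  have "\<exists>m>0. \<forall>t\<in>{0<..<1 / real m}. \<forall>x. norm (S t x) \<le> real m * norm x"
  proof (rule ccontr)
    assume "\<not> ?thesis"
    then have "\<forall>m. \<exists>t x. 0 < t \<and> t < 1 / real (Suc m) \<and> norm (S t x) > real (Suc m) * norm x"
      by (metis greaterThanLessThan_iff linorder_not_le zero_less_Suc)
    then obtain t x where t: "\<And>m. 0 < t m" "\<And>m. t m < 1 / real (Suc m)"
      and big: "\<And>m. norm (S (t m) (x m)) > real (Suc m) * norm (x m)"
      by metis
    have "t \<longlonglongrightarrow> 0"
      by (rule tendsto_sandwich[OF _ _ tendsto_const LIMSEQ_inverse_real_of_nat])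
        (use t less_imp_le in \<open>auto simp: inverse_eq_divide intro!: always_eventually\<close>)
    moreover have "\<forall>\<^sub>F m in sequentially. t m \<in> {0<..} \<and> t m \<noteq> 0"
    proof (intro always_eventually allI)
      show "t m \<in> {0<..} \<and> t m \<noteq> 0" for m using t(1)[of m] by simp
    qed
    ultimately have "filterlim t (at_right 0) sequentially"
      unfolding filterlim_at by blast
    then have lim: "(\<lambda>m. S (t m) f) \<longlonglongrightarrow> f" for f
      by (rule filterlim_compose[OF cont])
    have "\<exists>C. \<forall>k. norm (S (t k) f) \<le> C" for f
      using convergent_imp_Bseq[OF convergentI[OF lim[of f]]] by (auto simp: Bseq_def)
    then obtain C where C: "\<And>k f. norm (S (t k) f) \<le> C * norm f"
      using uniform_boundedness[of "\<lambda>k. S (t k)"] lin t(1) less_imp_le by blast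
    obtain k where k: "C \<le> real k" using real_arch_simple by blast
    have "real (Suc k) * norm (x k) < C * norm (x k)"
      using big[of k] C[of k "x k"] by linarith
    moreover have "C * norm (x k) \<le> real (Suc k) * norm (x k)"
      using k by (intro mult_right_mono) auto
    ultimately show False by simp
  qed
  then obtain m where m: "m > 0" "\<And>t x. 0 < t \<Longrightarrow> t < 1 / real m \<Longrightarrow> norm (S t x) \<le> real m * norm x"
    by auto
  have m': "norm (S t x) \<le> real m * norm x" if "0 \<le> t" "t < 1 / real m" for t x
  proof (cases "t = 0")
    case True
    have "1 * norm x \<le> real m * norm x" using m(1) by (intro mult_right_mono) auto
    then show ?thesis using True zero by simp
  qed (use m that in auto)
  have power: "norm (S (real k * t) x) \<le> real m ^ k * norm x" if t: "0 \<le> t" "t < 1 / real m" for k t x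
  proof (induction k)
    case 0
    show ?case by (simp add: zero)
  next
    case (Suc k)
    have "S (real (Suc k) * t) = S t \<circ> S (real k * t)"
      using add[of t "real k * t"] t by (simp add: algebra_simps)
    then have "norm (S (real (Suc k) * t) x) \<le> real m * norm (S (real k * t) x)"
      using m'[OF t] by simp
    also have "\<dots> \<le> real m * (real m ^ k * norm x)" by (intro mult_left_mono Suc) auto
    finally show ?case by simp
  qed
  obtain k where k: "real m * T < real k" using reals_Archimedean2 by blast
  have "norm (S t x) \<le> real m ^ k * norm x" if t: "t \<in> {0..T}" for t x
  proof (cases "k = 0")
    case True
    then show ?thesis using k t m(1) by (auto simp: mult_less_0_iff)
  next
    case False
    have "real m * t < real k" using k t m(1) by (smt (verit) atLeastAtMost_iff mult_left_mono of_nat_0_le_iff)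
    then have "t / real k < 1 / real m" using m(1) False by (simp add: field_simps)
    then show ?thesis using power[of "t / real k" k x] t False by simp
  qed
  then show ?thesis by (intro exI[of _ "real m ^ k"]) auto
qed

text \<open>
  Strong continuity at 0 gives continuity from the right; continuity from the left needs the local bound.
\<close>

lemma C0_semigroup_continuous_on:
  fixes S :: "real \<Rightarrow> 'a::banach \<Rightarrow> 'a"
  assumes S: "C0_semigroup S"
  shows "continuous_on {0..T} (\<lambda>t. S t f)"
proof -
  have lin: "\<And>t. t \<ge> 0 \<Longrightarrow> bounded_linear (S t)" and zero: "S 0 = id"
    and add: "\<And>s t. s \<ge> 0 \<Longrightarrow> t \<ge> 0 \<Longrightarrow> S (s + t) = S s \<circ> S t"
    and cont: "\<And>f. ((\<lambda>t. S t f) \<longlongrightarrow> f) (at_right 0)"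
    using S unfolding C0_semigroup_def by blast+
  obtain C where C: "C \<ge> 0" "\<And>t x. t \<in> {0..T} \<Longrightarrow> norm (S t x) \<le> C * norm x"
    using C0_semigroup_locally_bounded[OF S] by blast
  have step: "dist (S s f) (S t f) \<le> C * norm (S (t - s) f - f)" if st: "0 \<le> s" "s \<le> t" "t \<le> T" for s t
  proof -
    have "S t f = S s (S (t - s) f)" using add[of s "t - s"] st by simp
    then have "S t f - S s f = S s (S (t - s) f - f)"
      using lin[of s] st by (simp add: linear_simps)
    moreover have "norm (S s (S (t - s) f - f)) \<le> C * norm (S (t - s) f - f)"
      using st by (intro C(2)) auto
    ultimately show ?thesis by (metis dist_commute dist_norm)
  qed
  show ?thesis
    unfolding continuous_on_iff
  proof (intro ballI allI impI)
    fix t e :: real assume t: "t \<in> {0..T}" and e: "e > 0"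
    have "\<forall>\<^sub>F h in at_right 0. dist (S h f) f < e / (C + 1)"
      using cont[of f] e C(1) by (intro tendstoD) auto
    then obtain d where d: "d > 0" "\<And>h. 0 < h \<Longrightarrow> h < d \<Longrightarrow> dist (S h f) f < e / (C + 1)"
      unfolding eventually_at_right_field by auto
    have close: "C * norm (S h f - f) < e" if h: "0 \<le> h" "h < d" for h
    proof (cases "h = 0")
      case False
      then have "norm (S h f - f) < e / (C + 1)" using d(2)[of h] h by (simp add: dist_norm)
      then have "(C + 1) * norm (S h f - f) < e" using C(1) by (simp add: field_simps)
      then show ?thesis using norm_ge_zero[of "S h f - f"] unfolding distrib_right by linarith
    qed (use e zero in simp)
    show "\<exists>d>0. \<forall>s\<in>{0..T}. dist s t < d \<longrightarrow> dist (S s f) (S t f) < e"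
    proof (intro exI conjI ballI impI)
      fix s assume s: "s \<in> {0..T}" "dist s t < d"
      show "dist (S s f) (S t f) < e"
      proof (cases "s \<le> t")
        case True
        then show ?thesis using step[of s t] close[of "t - s"] s t by (simp add: dist_norm)
      next
        case False
        then show ?thesis using step[of t s] close[of "s - t"] s t by (simp add: dist_norm norm_minus_commute)
      qed
    qed (rule d)
  qed
qed

text \<open>
  The evolution equation in integrated form, which holds for every initial state and not only for
  those in the domain of the generator.
\<close>

lemma C0_semigroup_integral_generator:
  fixes S :: "real \<Rightarrow> 'a::banach \<Rightarrow> 'a"
  assumes S: "C0_semigroup S" and t: "0 \<le> t"
  shows "(integral {0..t} (\<lambda>s. S s f), S t f - f) \<in> generator_graph S"
proof -
  have lin: "\<And>t. t \<ge> 0 \<Longrightarrow> bounded_linear (S t)" and zero: "S 0 = id"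
    and add: "\<And>s t. s \<ge> 0 \<Longrightarrow> t \<ge> 0 \<Longrightarrow> S (s + t) = S s \<circ> S t"
    using S unfolding C0_semigroup_def by blast+
  define X where "X t = integral {0..t} (\<lambda>s. S s f)" for t
  have int: "(\<lambda>s. S s f) integrable_on {a..b}" if "0 \<le> a" for a b
    by (rule integrable_continuous_interval, rule continuous_on_subset[OF C0_semigroup_continuous_on[OF S, where T = b]])
      (use that in auto)
  (* The fundamental theorem of calculus at r = t and at r = 0. *)
  have quot: "((\<lambda>h. (X (r + h) - X r) /\<^sub>R h) \<longlongrightarrow> S r f) (at_right 0)" if r: "0 \<le> r" for r
  proof -
    have "(X has_vector_derivative S r f) (at r within {0..r + 1})"
      unfolding X_def using r
      by (intro integral_has_vector_derivative C0_semigroup_continuous_on[OF S]) auto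
    then have "(X has_vector_derivative S r f) (at r within {r..r + 1})"
      by (rule has_vector_derivative_within_subset) (use r in auto)
    then have der: "\<exists>d>0. \<forall>y\<in>{r..r + 1}. norm (y - r) < d \<longrightarrow>
        norm (X y - X r - (y - r) *\<^sub>R S r f) \<le> e * norm (y - r)" if "e > 0" for e
      using that by (simp add: has_vector_derivative_def has_derivative_within_alt)
    show ?thesis
    proof (rule tendstoI)
      fix e :: real assume e: "e > 0"
      obtain d where d: "d > 0" "\<And>y. y \<in> {r..r + 1} \<Longrightarrow> norm (y - r) < d \<Longrightarrow>
          norm (X y - X r - (y - r) *\<^sub>R S r f) \<le> e / 2 * norm (y - r)"
        using der[of "e / 2"] e by auto
      have "\<forall>\<^sub>F h in at_right 0. h \<in> {0<..<min d 1}"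
        using d by (intro eventually_at_right_real) auto
      then show "\<forall>\<^sub>F h in at_right 0. dist ((X (r + h) - X r) /\<^sub>R h) (S r f) < e"
      proof eventually_elim
        case (elim h)
        have "(X (r + h) - X r) /\<^sub>R h - S r f = (X (r + h) - X r - h *\<^sub>R S r f) /\<^sub>R h"
          using elim by (simp add: scaleR_diff_right)
        then have "dist ((X (r + h) - X r) /\<^sub>R h) (S r f) = norm (X (r + h) - X r - h *\<^sub>R S r f) / h"
          using elim by (simp add: dist_norm divide_inverse_commute)
        also have "\<dots> \<le> e / 2"
          using d(2)[of "r + h"] elim by (simp add: divide_le_eq)
        finally show ?case using e by simp
      qed
    qed
  qed
  have shift: "S h (X t) - X t = (X (t + h) - X t) - X h" if h: "0 < h" for h
  proof -
    have hs: "S h (S s f) = S (s + h) f" if "0 \<le> s" for s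
      using add[of h s] h that by (simp add: add.commute)
    have "S h (X t) = integral {0..t} (\<lambda>s. S h (S s f))"
      unfolding X_def using integral_linear[OF int lin[of h], of 0 t] h by (simp add: o_def)
    also have "\<dots> = integral {0..t} (\<lambda>s. S (s + h) f)"
      by (rule Henstock_Kurzweil_Integration.integral_cong) (simp add: hs)
    also have "\<dots> = integral {h..t + h} (\<lambda>s. S s f)"
      using integral_shift_cbox[of h h "t + h" "\<lambda>s. S s f"] by simp
    also have "\<dots> = X (t + h) - X h"
      unfolding X_def
      using Henstock_Kurzweil_Integration.integral_combine[OF _ _ int[of 0 "t + h"], of h] h t
      by (simp add: algebra_simps)
    finally show ?thesis by simp
  qed
  have "((\<lambda>h. (X (t + h) - X t) /\<^sub>R h - (X (0 + h) - X 0) /\<^sub>R h) \<longlongrightarrow> S t f - S 0 f) (at_right 0)"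
    by (intro tendsto_diff quot t order_refl)
  then have "((\<lambda>h. (X (t + h) - X t) /\<^sub>R h - (X (0 + h) - X 0) /\<^sub>R h) \<longlongrightarrow> S t f - f) (at_right 0)"
    by (simp add: zero)
  then have "((\<lambda>h. (S h (X t) - X t) /\<^sub>R h) \<longlongrightarrow> S t f - f) (at_right 0)"
  proof (rule Lim_transform_eventually)
    show "\<forall>\<^sub>F h in at_right 0. (X (t + h) - X t) /\<^sub>R h - (X (0 + h) - X 0) /\<^sub>R h = (S h (X t) - X t) /\<^sub>R h"
      using eventually_at_right_less[of 0]
      by eventually_elim (simp add: shift X_def[of 0] scaleR_diff_right)
  qed
  then show ?thesis unfolding generator_graph_def X_def[symmetric] by simp
qed

section \<open>Eigenvectors of complex matrices\<close>

context
  fixes F :: "complex^'n \<Rightarrow> complex^'n"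
  assumes F_add: "\<And>x y. F (x + y) = F x + F y"
    and F_scale: "\<And>c x. F (c *s x) = c *s F x"
begin

text \<open>The vector \<open>p(F) x\<close>, evaluated by Horner's scheme.\<close>

definition poly_of_map :: "complex poly \<Rightarrow> complex^'n \<Rightarrow> complex^'n" where
  "poly_of_map p x = fold_coeffs (\<lambda>a y. a *s x + F y) p 0"

lemma F_zero: "F 0 = 0"
  using F_scale[of 0 0] by simp

lemma poly_of_map_0 [simp]: "poly_of_map 0 x = 0"
  by (simp add: poly_of_map_def)

lemma poly_of_map_pCons [simp]: "poly_of_map (pCons a p) x = a *s x + F (poly_of_map p x)"
  by (cases "p = 0 \<and> a = 0") (auto simp: poly_of_map_def F_zero)

lemma poly_of_map_add: "poly_of_map (p + q) x = poly_of_map p x + poly_of_map q x"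
  by (induction p q rule: poly_induct2) (simp_all add: F_add vec.scale_left_distrib)

lemma poly_of_map_smult: "poly_of_map (smult c p) x = c *s poly_of_map p x"
  by (induction p) (simp_all add: F_scale vec.scale_right_distrib)

lemma poly_of_map_sum: "poly_of_map (\<Sum>i\<in>I. p i) x = (\<Sum>i\<in>I. poly_of_map (p i) x)"
  by (induction I rule: infinite_finite_induct) (simp_all add: poly_of_map_add)

lemma poly_of_map_monom: "poly_of_map (monom c i) x = c *s (F ^^ i) x"
  by (induction i) (simp_all add: monom_0 monom_Suc F_scale F_zero)

lemma poly_of_map_mem:
  assumes "\<And>x y. x \<in> E \<Longrightarrow> y \<in> E \<Longrightarrow> x + y \<in> E" "\<And>c x. x \<in> E \<Longrightarrow> c *s x \<in> E"
    "\<And>x. x \<in> E \<Longrightarrow> F x \<in> E" "x \<in> E"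
  shows "poly_of_map p x \<in> E"
proof (induction p)
  case 0
  show ?case using assms(2)[of x 0] assms(4) by simp
qed (use assms in simp)

text \<open>
  The iterates of \<open>F\<close> at \<open>x\<close> up to the real dimension of the space either repeat or are linearly
  dependent over the reals.
\<close>

lemma annihilating_poly: "\<exists>p. p \<noteq> 0 \<and> poly_of_map p x = 0"
proof -
  define J where "J = {..DIM(complex^'n)}"
  define f where "f i = (F ^^ i) x" for i
  show ?thesis
  proof (cases "inj_on f J")
    case False
    then obtain i j where ij: "f i = f j" "i \<noteq> j"
      unfolding inj_on_def by blast
    have "poly_of_map (monom 1 i + monom (- 1) j) x = 0"
      using ij(1) by (simp add: poly_of_map_add poly_of_map_monom f_def vec_eq_iff)
    moreover have "coeff (monom 1 i + monom (- 1) j :: complex poly) i \<noteq> 0"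
      using ij(2) by simp
    ultimately show ?thesis by (metis coeff_0)
  next
    case True
    have "dependent (f ` J)"
      by (rule dependent_biggerset) (unfold card_image[OF True], simp add: J_def)
    then obtain u k where k: "k \<in> J" "u (f k) \<noteq> 0" and u: "(\<Sum>y\<in>f ` J. u y *\<^sub>R y) = 0"
      by (subst (asm) dependent_finite) (auto simp: J_def)
    define p where "p = (\<Sum>i\<in>J. monom (complex_of_real (u (f i))) i)"
    have "poly_of_map p x = (\<Sum>i\<in>J. complex_of_real (u (f i)) *s f i)"
      by (simp add: p_def poly_of_map_sum poly_of_map_monom f_def)
    also have "\<dots> = (\<Sum>i\<in>J. u (f i) *\<^sub>R f i)"
      by (intro sum.cong refl) (simp add: vec_eq_iff, simp add: scaleR_conv_of_real)
    also have "\<dots> = 0"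
      using u by (simp add: sum.reindex[OF True])
    finally have "poly_of_map p x = 0" .
    moreover have "coeff p k = complex_of_real (u (f k))"
      using k(1) by (simp add: p_def coeff_sum J_def if_distrib sum.delta cong: if_cong)
    then have "p \<noteq> 0" using k(2) by auto
    ultimately show ?thesis by blast
  qed
qed

text \<open>
  If \<open>p\<close> has minimal degree among the nonzero polynomials with \<open>p(F) x = 0\<close> and \<open>p = (X - a) q\<close>, then
  \<open>q(F) x\<close> is an eigenvector for \<open>a\<close>.
\<close>

lemma eigenvector_in_invariant_subspace:
  assumes E: "\<And>x y. x \<in> E \<Longrightarrow> y \<in> E \<Longrightarrow> x + y \<in> E" "\<And>c x. x \<in> E \<Longrightarrow> c *s x \<in> E"
    and inv: "\<And>x. x \<in> E \<Longrightarrow> F x \<in> E" and x: "x \<in> E" "x \<noteq> 0"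
  shows "\<exists>y a. y \<in> E \<and> y \<noteq> 0 \<and> F y = a *s y"
proof -
  define d where "d = (LEAST n. \<exists>p. p \<noteq> 0 \<and> poly_of_map p x = 0 \<and> degree p = n)"
  have "\<exists>n. \<exists>p. p \<noteq> 0 \<and> poly_of_map p x = 0 \<and> degree p = n"
    using annihilating_poly by blast
  then have "\<exists>p. p \<noteq> 0 \<and> poly_of_map p x = 0 \<and> degree p = d"
    unfolding d_def by (rule LeastI_ex)
  then obtain p where p: "p \<noteq> 0" "poly_of_map p x = 0" "degree p = d" by blast
  have min: "d \<le> degree q" if "q \<noteq> 0" "poly_of_map q x = 0" for q
    unfolding d_def by (rule Least_le) (use that in blast)
  have "d \<noteq> 0"
  proof
    assume "d = 0"
    then obtain a where "p = [:a:]" using p(3) degree_eq_zeroE by blast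
    then show False using p x(2) by (auto simp: F_zero)
  qed
  then have "\<not> constant (poly p)"
    using p(3) by (simp add: constant_degree)
  then obtain a where "poly p a = 0"
    using fundamental_theorem_of_algebra by blast
  then obtain q where q: "p = [:- a, 1:] * q"
    unfolding poly_eq_0_iff_dvd by (rule dvdE)
  have "q \<noteq> 0" using p(1) q by auto
  then have "degree q < d"
    using p(3) q degree_mult_eq[of "[:- a, 1:]" q] by simp
  then have "poly_of_map q x \<noteq> 0"
    using min \<open>q \<noteq> 0\<close> by force
  moreover have "poly_of_map p x = F (poly_of_map q x) - a *s poly_of_map q x"
  proof -
    have "p = pCons 0 q + smult (- a) q" by (simp add: q)
    then show ?thesis
      by (simp only: poly_of_map_add poly_of_map_smult poly_of_map_pCons) (simp add: vec_eq_iff)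
  qed
  moreover have "poly_of_map q x \<in> E"
    by (rule poly_of_map_mem[OF E inv x(1)])
  ultimately show ?thesis using p(2) by auto
qed

end

definition diag_matrix :: "('n \<Rightarrow> 'a::zero) \<Rightarrow> 'a^'n^'n" where
  "diag_matrix d = (\<chi> i j. if i = j then d i else 0)"

lemma diag_matrix_mult:
  "diag_matrix d ** diag_matrix e = diag_matrix (\<lambda>i. d i * e i :: 'a::semiring_1)"
proof -
  have "(\<Sum>k\<in>UNIV. (if i = k then d i else 0) * (if k = j then e k else 0))
      = (if i = j then d i * e i else 0)" for i j
  proof -
    have "(\<Sum>k\<in>UNIV. (if i = k then d i else 0) * (if k = j then e k else 0))
        = (\<Sum>k\<in>UNIV. if k = i then d i * (if k = j then e k else 0) else 0)"
      by (intro sum.cong) auto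
    then show ?thesis by simp
  qed
  then show ?thesis by (simp add: diag_matrix_def matrix_matrix_mult_def vec_eq_iff)
qed

text \<open>
  In a basis of eigenvectors, \<open>P\<close> is the projection onto the eigenspace of \<open>c\<close>, and \<open>R\<close> inverts
  \<open>A - c\<close> on the other eigenspaces and vanishes on this one.
\<close>

lemma reduced_resolvent:
  fixes A :: "'a::field^'n^'n"
  assumes "diagonalizable A"
  shows "\<exists>R P. P ** (A - mat c) = 0 \<and> R ** (A - mat c) = mat 1 - P"
proof -
  obtain Q X :: "'a^'n^'n" where Q: "invertible Q" and X: "\<And>i j. i \<noteq> j \<Longrightarrow> X $ i $ j = 0"
    and A: "A = Q ** X ** matrix_inv Q"
    using assms unfolding diagonalizable_def by metis
  define d where "d i = X $ i $ i - c" for i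
  define cj where "cj e = Q ** diag_matrix e ** matrix_inv Q" for e :: "'n \<Rightarrow> 'a"
  have inv: "matrix_inv Q ** Q = mat 1" "Q ** matrix_inv Q = mat 1"
    using someI_ex[OF Q[unfolded invertible_def], folded matrix_inv_def] by auto
  have cj_mult: "cj e ** cj e' = cj (\<lambda>i. e i * e' i)" for e e'
  proof -
    have "cj e ** cj e' = Q ** diag_matrix e ** (matrix_inv Q ** Q) ** diag_matrix e' ** matrix_inv Q"
      unfolding cj_def by (simp only: matrix_mul_assoc)
    also have "\<dots> = Q ** (diag_matrix e ** diag_matrix e') ** matrix_inv Q"
      unfolding inv(1) by (simp only: matrix_mul_assoc matrix_mul_rid)
    finally show ?thesis unfolding cj_def diag_matrix_mult .
  qed
  have cj_diff: "cj (\<lambda>i. e i - e' i) = cj e - cj e'" for e e'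
  proof -
    have "diag_matrix (\<lambda>i. e i - e' i) = diag_matrix e - diag_matrix e'"
      by (simp add: diag_matrix_def vec_eq_iff)
    then show ?thesis
      by (simp add: cj_def matrix_matrix_mult_def vec_eq_iff sum_subtractf left_diff_distrib right_diff_distrib)
  qed
  have cj_const: "cj (\<lambda>i. a) = mat a" for a
  proof -
    have "diag_matrix (\<lambda>i. a) = (mat a :: 'a^'n^'n)" by (simp add: diag_matrix_def mat_def vec_eq_iff)
    moreover have "Q ** mat a = mat a ** Q"
      by (simp add: matrix_matrix_mult_def mat_def vec_eq_iff if_distrib if_distribR mult.commute cong: if_cong)
    ultimately have "cj (\<lambda>i. a) = mat a ** (Q ** matrix_inv Q)"
      unfolding cj_def matrix_mul_assoc by simp
    then show ?thesis unfolding inv(2) by simp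
  qed
  have "X = diag_matrix (\<lambda>i. X $ i $ i)"
    using X by (simp add: diag_matrix_def vec_eq_iff)
  then have "A = cj (\<lambda>i. X $ i $ i)"
    unfolding cj_def A by simp
  then have Ac: "A - mat c = cj d"
    unfolding d_def[abs_def] cj_diff cj_const by simp
  define P where "P = cj (\<lambda>i. if d i = 0 then 1 else 0)"
  have "P ** (A - mat c) = 0"
  proof -
    have "P ** (A - mat c) = cj (\<lambda>i. 0)"
      unfolding Ac P_def cj_mult by (rule arg_cong[where f = cj]) auto
    then show ?thesis unfolding cj_const by (simp add: mat_def vec_eq_iff)
  qed
  (* As inverse 0 = 0, the factor inverse (d i) * d i is 0 on the eigenspace of c and 1 elsewhere. *)
  moreover have "cj (\<lambda>i. inverse (d i)) ** (A - mat c) = cj (\<lambda>i. 1 - (if d i = 0 then 1 else 0))"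
    unfolding Ac cj_mult by (rule arg_cong[where f = cj]) auto
  then have "cj (\<lambda>i. inverse (d i)) ** (A - mat c) = mat 1 - P"
    unfolding cj_diff cj_const P_def .
  ultimately show ?thesis by blast
qed

lemma row_eigenvector_exists:
  fixes A :: "'a::field^'n^'n"
  assumes "c \<in> spectrum A"
  shows "\<exists>v. v \<noteq> 0 \<and> v v* A = c *s v"
proof -
  obtain x where x: "x \<noteq> 0" "A *v x = c *s x"
    using assms unfolding spectrum_def by blast
  have "mat c *v x = c *s x"
    by (simp add: matrix_vector_mult_def mat_def vec_eq_iff if_distrib if_distribR cong: if_cong)
  with x have "x \<noteq> 0" "(A - mat c) *v x = 0"
    by (simp_all add: matrix_vector_mult_diff_rdistrib)
  then have "\<not> invertible (A - mat c)"
    unfolding invertible_left_inverse matrix_left_invertible_ker by blast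
  then have "\<not> invertible (transpose (A - mat c))"
    by (simp add: invertible_det_nz det_transpose)
  then obtain v where v: "v \<noteq> 0" "transpose (A - mat c) *v v = 0"
    unfolding invertible_left_inverse matrix_left_invertible_ker by blast
  then have "v v* (A - mat c) = 0" by simp
  then have "v v* A = v v* mat c"
    by (simp add: vector_matrix_mult_diff_rdistrib)
  also have "\<dots> = c *s v"
    by (simp add: vector_matrix_mult_def mat_def vec_eq_iff if_distrib cong: if_cong)
  finally show ?thesis using v(1) by blast
qed

section \<open>The approximate hyperbolic eigenvector\<close>

definition pair_vec :: "'a^'h \<Rightarrow> 'a^'p \<Rightarrow> 'a^('h::finite + 'p::finite)" where
  "pair_vec a b = (\<chi> i. case i of Inl j \<Rightarrow> a $ j | Inr j \<Rightarrow> b $ j)"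

lemma sum_UNIV_Plus:
  "(\<Sum>i\<in>(UNIV :: ('h::finite + 'p::finite) set). f i) = (\<Sum>i\<in>UNIV. f (Inl i)) + (\<Sum>i\<in>UNIV. f (Inr i))"
  by (simp add: UNIV_Plus_UNIV[symmetric] sum.Plus del: UNIV_Plus_UNIV)

lemma pair_vec_block_matrix:
  "pair_vec a b v* complex_matrix (block_matrix P Q R S)
     = pair_vec (a v* complex_matrix P + b v* complex_matrix R) (a v* complex_matrix Q + b v* complex_matrix S)"
  unfolding vec_eq_iff
proof
  fix j
  show "(pair_vec a b v* complex_matrix (block_matrix P Q R S)) $ j
     = pair_vec (a v* complex_matrix P + b v* complex_matrix R) (a v* complex_matrix Q + b v* complex_matrix S) $ j"
    by (cases j) (simp_all add: pair_vec_def complex_matrix_def block_matrix_def vector_matrix_mult_def sum_UNIV_Plus)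
qed

lemma block_matrix_exists: "\<exists>P Q R S. K = block_matrix P Q R S"
proof -
  have "K = block_matrix (\<chi> a b. K $ Inl a $ Inl b) (\<chi> a b. K $ Inl a $ Inr b)
      (\<chi> a b. K $ Inr a $ Inl b) (\<chi> a b. K $ Inr a $ Inr b)"
    by (simp add: block_matrix_def vec_eq_iff split: sum.split)
  then show ?thesis by blast
qed

text \<open>
  The last three conditions say that the terms of order \<open>n\<^sup>2\<close>, \<open>n\<close> and \<open>1\<close> vanish in
  \<open>w L\<^sub>n - (i n \<mu> + l) w\<close> for \<open>w = W0 + W1 / n + W2 / n\<^sup>2\<close> with \<open>W0 = (v, 0)\<close>. Put \<open>W1 = (q, p)\<close> and
  \<open>W2 = (0, p2)\<close>. As \<open>D\<close> is invertible, the parabolic components of the equations determine \<open>p\<close> and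
  then \<open>p2\<close>. The hyperbolic component at order \<open>1\<close> becomes \<open>v C - l v + i q (A' - \<mu>) = 0\<close>, where \<open>C\<close>
  combines the hyperbolic block of \<open>K\<close> with the feedback through the parabolic components. It can be
  solved for \<open>q\<close> exactly when \<open>v C - l v\<close> has no component in the eigenspace of \<open>\<mu>\<close>; so \<open>v\<close> must
  be an eigenvector of \<open>v \<mapsto> v C P\<close>, where \<open>P\<close> projects onto that eigenspace.
\<close>

lemma formal_hyperbolic_eigenvector:
  fixes D :: "real^'p^'p" and A' :: "real^'h^'h" and K :: "real^('h + 'p)^('h + 'p)"
  assumes D: "0 \<notin> spectrum (complex_matrix D)"
    and A': "diagonalizable (complex_matrix A')" and \<mu>: "\<mu> \<in> spectrum (complex_matrix A')"
    and B: "B = block_matrix 0 0 0 D" and A: "A = block_matrix A' A12 A21 A22"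
  obtains v W1 W2 l where "v \<noteq> 0" "v v* complex_matrix A' = \<mu> *s v"
    "pair_vec v 0 v* complex_matrix B = 0"
    "\<i> *s (pair_vec v 0 v* complex_matrix A - \<mu> *s pair_vec v 0) + W1 v* complex_matrix B = 0"
    "pair_vec v 0 v* complex_matrix K - l *s pair_vec v 0
       + \<i> *s (W1 v* complex_matrix A - \<mu> *s W1) + W2 v* complex_matrix B = 0"
proof -
  let ?c = complex_matrix
  have "invertible (?c D)"
    unfolding invertible_left_inverse matrix_left_invertible_ker
    using D by (auto simp: spectrum_def)
  then obtain D1 where D1: "D1 ** ?c D = mat 1" unfolding invertible_def by blast
  obtain R P where P: "P ** (?c A' - mat \<mu>) = 0" and R: "R ** (?c A' - mat \<mu>) = mat 1 - P"
    using reduced_resolvent[OF A'] by blast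
  obtain K11 K12 K21 K22 where K: "K = block_matrix K11 K12 K21 K22"
    using block_matrix_exists by blast
  define C where "C = ?c K11 + ?c A12 ** D1 ** ?c A21"
  define E where "E = {v. v v* (?c A' - mat \<mu>) = 0}"
  have mat_\<mu>: "v v* mat \<mu> = \<mu> *s v" for v :: "complex^'h"
    by (simp add: vector_matrix_mult_def mat_def vec_eq_iff if_distrib cong: if_cong)
  have E_iff: "v \<in> E \<longleftrightarrow> v v* ?c A' = \<mu> *s v" for v
    by (simp add: E_def vector_matrix_mult_diff_rdistrib mat_\<mu>)
  obtain v0 where v0: "v0 \<noteq> 0" "v0 \<in> E"
    using row_eigenvector_exists[OF \<mu>] E_iff by blast
  have "\<exists>v l. v \<in> E \<and> v \<noteq> 0 \<and> v v* C v* P = l *s v"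
  proof (rule eigenvector_in_invariant_subspace[OF _ _ _ _ _ v0(2,1)])
    show "v v* C v* P \<in> E" for v
      unfolding E_def mem_Collect_eq by (simp only: vector_matrix_mul_assoc[of _ P] P vector_matrix_mult_0_right)
  qed (auto simp: E_iff vector_matrix_left_distrib scalar_vector_matrix_assoc vec.scale_right_distrib)
  then obtain v l where v: "v \<in> E" "v \<noteq> 0" "v v* C v* P = l *s v" by blast
  define q where "q = \<i> *s (v v* C v* R)"
  define p where "p = (- \<i>) *s (v v* ?c A12 v* D1)"
  define p2 where "p2 = (- 1) *s (v v* ?c K12 + \<i> *s (q v* ?c A12 + p v* ?c A22 - \<mu> *s p)) v* D1"
  have D1_row: "y v* D1 v* ?c D = y" for y
    by (simp add: vector_matrix_mul_assoc D1)
  have pD: "p v* ?c D = (- \<i>) *s (v v* ?c A12)"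
    by (simp only: p_def scalar_vector_matrix_assoc D1_row)
  have "\<i> *s (q v* ?c A' - \<mu> *s q) = \<i> *s (q v* (?c A' - mat \<mu>))"
    by (simp add: vector_matrix_mult_diff_rdistrib mat_\<mu>)
  also have "\<dots> = - (v v* C v* R v* (?c A' - mat \<mu>))"
    by (simp add: q_def scalar_vector_matrix_assoc)
  also have "\<dots> = - (v v* C) + l *s v"
    unfolding vector_matrix_mul_assoc[of _ R] R by (simp add: vector_matrix_mult_diff_rdistrib v(3))
  finally have q: "\<i> *s (q v* ?c A' - \<mu> *s q) = - (v v* C) + l *s v" .
  have c0: "?c 0 = 0" by (simp add: complex_matrix_def vec_eq_iff)
  have pair_arith: "pair_vec a b + pair_vec a' b' = pair_vec (a + a') (b + b')"
    "pair_vec a b - pair_vec a' b' = pair_vec (a - a') (b - b')"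
    "c *s pair_vec a b = pair_vec (c *s a) (c *s b)" "pair_vec 0 0 = 0"
    for a a' :: "complex^'h" and b b' :: "complex^'p" and c
    by (simp_all add: pair_vec_def vec_eq_iff split: sum.split)
  show thesis
  proof (rule that)
    show "v \<noteq> 0" by (rule v)
    show vA: "v v* ?c A' = \<mu> *s v" using v(1) E_iff by blast
    show "pair_vec v 0 v* ?c B = 0"
      by (simp add: B pair_vec_block_matrix c0 pair_arith)
    show "\<i> *s (pair_vec v 0 v* ?c A - \<mu> *s pair_vec v 0) + pair_vec q p v* ?c B = 0"
      by (simp add: A B pair_vec_block_matrix c0 pair_arith vA pD)
    have "\<i> *s (p v* ?c A21) = v v* (?c A12 ** D1 ** ?c A21)"
      unfolding p_def scalar_vector_matrix_assoc vector_matrix_mul_assoc by simp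
    moreover have "v v* ?c K11 - l *s v + \<i> *s (q v* ?c A' + p v* ?c A21 - \<mu> *s q)
        = v v* ?c K11 - l *s v + (- (v v* C) + l *s v) + \<i> *s (p v* ?c A21)"
      unfolding q[symmetric] by (simp add: vec.scale_right_distrib vec.scale_right_diff_distrib)
    ultimately have h: "v v* ?c K11 - l *s v + \<i> *s (q v* ?c A' + p v* ?c A21 - \<mu> *s q) = 0"
      by (simp add: C_def vector_matrix_mult_add_rdistrib)
    have "p2 v* ?c D = (- 1) *s (v v* ?c K12 + \<i> *s (q v* ?c A12 + p v* ?c A22 - \<mu> *s p))"
      unfolding p2_def D1_row ..
    with h show "pair_vec v 0 v* ?c K - l *s pair_vec v 0
       + \<i> *s (pair_vec q p v* ?c A - \<mu> *s pair_vec q p) + pair_vec 0 p2 v* ?c B = 0"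
      by (simp add: K A B pair_vec_block_matrix c0 pair_arith)
  qed
qed

text \<open>
  The eigenvector \<open>v\<close> is complex, but its real and imaginary parts are real elements of the kernel,
  since \<open>A'\<close> and \<open>\<mu>\<close> are real.
\<close>

lemma complex_row_kernel:
  fixes A' :: "real^'h^'h" and M :: "real^'m^('h + 'p::finite)"
  assumes M: "\<And>V0. (transpose A' - mat \<mu>) *v V0 = 0 \<Longrightarrow> transpose M *v pad_zero V0 = 0"
    and v: "v v* complex_matrix A' = complex_of_real \<mu> *s v"
  shows "pair_vec v 0 v* complex_matrix M = 0"
proof -
  define re where "re = (\<chi> j. Re (v $ j))"
  define im where "im = (\<chi> j. Im (v $ j))"
  have comp: "(\<Sum>i\<in>UNIV. v $ i * complex_of_real (A' $ i $ j)) = complex_of_real \<mu> * v $ j" for j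
    using v by (simp add: vec_eq_iff vector_matrix_mult_def complex_matrix_def)
  have mat_\<mu>: "mat \<mu> *v x = \<mu> *s x" for x :: "real^'h"
    by (simp add: matrix_vector_mult_def mat_def vec_eq_iff if_distrib if_distribR cong: if_cong)
  have "(transpose A' - mat \<mu>) *v re = 0"
    using arg_cong[OF comp, of Re]
    by (simp add: matrix_vector_mult_diff_rdistrib mat_\<mu> vector_matrix_mult_def vec_eq_iff re_def)
  then have re: "transpose M *v pad_zero re = 0" by (rule M)
  have "(transpose A' - mat \<mu>) *v im = 0"
    using arg_cong[OF comp, of Im]
    by (simp add: matrix_vector_mult_diff_rdistrib mat_\<mu> vector_matrix_mult_def vec_eq_iff im_def)
  then have im: "transpose M *v pad_zero im = 0" by (rule M)
  show ?thesis
    using re im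
    by (simp add: vec_eq_iff vector_matrix_mult_def pad_zero_def pair_vec_def sum_UNIV_Plus
        complex_matrix_def complex_eq_iff re_def im_def)
qed

section \<open>Fourier coefficients\<close>

text \<open>
  Writing Fourier coefficients as inner products with fixed elements of \<open>L\<^sup>2\<close> makes their linearity and
  continuity immediate.
\<close>

definition cos_mode :: "int \<Rightarrow> 'n \<Rightarrow> (real^'n) L2" where
  "cos_mode n j = L2_class (\<lambda>x. cos (of_int n * x) *\<^sub>R axis j 1)"

definition sin_mode :: "int \<Rightarrow> 'n \<Rightarrow> (real^'n) L2" where
  "sin_mode n j = L2_class (\<lambda>x. sin (of_int n * x) *\<^sub>R axis j 1)"

lemma borel_measurable_circleI: "f \<in> borel_measurable borel \<Longrightarrow> f \<in> borel_measurable circle"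
  unfolding circle_def by (intro measurable_restrict_space1) simp

lemma square_integrable_trig:
  "square_integrable (\<lambda>x. cos (of_int n * x) *\<^sub>R (c :: 'a::euclidean_space))"
  "square_integrable (\<lambda>x. sin (of_int n * x) *\<^sub>R (c :: 'a::euclidean_space))"
  by (rule square_integrable_bounded[where C = "norm c"]; force intro!: borel_measurable_circleI
      borel_measurable_continuous_onI continuous_intros mult_left_le_one_le)+

text \<open>
  The exact bound is \<open>sqrt (2 * pi)\<close>; with \<open>pi\<close> the bound for Fourier coefficients below has constant 1.
\<close>

lemma norm_L2_class_le:
  assumes f: "square_integrable f" and le: "\<And>x. norm (f x) \<le> 1"
  shows "norm (L2_class f) \<le> pi"
proof -
  have "(norm (L2_class f))\<^sup>2 = (\<integral>x. (norm (f x))\<^sup>2 \<partial>circle)" by (rule norm_L2_class[OF f])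
  also have "\<dots> \<le> (\<integral>x. 1 \<partial>circle)"
    using f le by (intro integral_mono) (auto simp: square_integrable_def intro: power_le_one)
  also have "\<dots> = 2 * pi" by (simp add: space_circle circle_def measure_restrict_space)
  also have "\<dots> \<le> pi\<^sup>2" using pi_ge_two by (simp add: power2_eq_square)
  finally show ?thesis by (simp add: power2_le_iff_abs_le)
qed

lemma norm_trig_modes: "norm (cos_mode n j) \<le> pi" "norm (sin_mode n j) \<le> pi"
  unfolding cos_mode_def sin_mode_def
  by (rule norm_L2_class_le; simp add: square_integrable_trig)+

lemma inner_trig_modes:
  fixes f :: "(real^'n) L2"
  shows
  "f \<bullet> cos_mode n j = (\<integral>x. component f j x * cos (of_int n * x) \<partial>circle)"
  "f \<bullet> sin_mode n j = (\<integral>x. component f j x * sin (of_int n * x) \<partial>circle)"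
proof -
  have "f \<bullet> L2_class (\<lambda>x. h x *\<^sub>R axis j 1) = (\<integral>x. component f j x * h x \<partial>circle)"
    if "square_integrable (\<lambda>x. h x *\<^sub>R axis j 1 :: real^'n)" for h
    using inner_L2_class[OF square_integrable_rep_L2[of f] that]
    by (simp add: L2_class_rep_L2 component_def inner_axis mult.commute)
  then show "f \<bullet> cos_mode n j = (\<integral>x. component f j x * cos (of_int n * x) \<partial>circle)"
    "f \<bullet> sin_mode n j = (\<integral>x. component f j x * sin (of_int n * x) \<partial>circle)"
    unfolding cos_mode_def sin_mode_def by (simp_all add: square_integrable_trig)
qed

lemma fourier_coeff_inner:
  fixes f :: "(real^'n) L2"
  shows "fourier_coeff f n $ j = (of_real (f \<bullet> cos_mode n j) - \<i> * of_real (f \<bullet> sin_mode n j)) / of_real (2 * pi)"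
proof -
  have int: "integrable circle (\<lambda>x. component f j x * h x)"
    if "square_integrable (\<lambda>x. h x *\<^sub>R axis j 1 :: real^'n)" for h
    using integrable_inner[OF square_integrable_rep_L2[of f] that]
    by (simp add: component_def inner_axis mult.commute)
  let ?c = "\<lambda>x. component f j x * cos (of_int n * x)" and ?s = "\<lambda>x. component f j x * sin (of_int n * x)"
  have c: "integrable circle ?c" and s: "integrable circle ?s"
    by (intro int square_integrable_trig)+
  have "(\<integral>x. complex_of_real (rep_L2 f x $ j) * cis (- (of_int n * x)) \<partial>circle)
      = (\<integral>x. complex_of_real (?c x) - \<i> * complex_of_real (?s x) \<partial>circle)"
    by (intro Bochner_Integration.integral_cong refl)
      (simp add: component_def complex_eq_iff)
  also have "\<dots> = complex_of_real (\<integral>x. ?c x \<partial>circle) - \<i> * complex_of_real (\<integral>x. ?s x \<partial>circle)"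
    using c s by (subst Bochner_Integration.integral_diff) (auto simp del: of_real_mult)
  finally show ?thesis
    by (simp add: fourier_coeff_def inner_trig_modes)
qed

text \<open>
  Left eigenvectors act on states as row vectors, so this pairing is bilinear, without complex
  conjugation.
\<close>

definition rowdot :: "complex^'n \<Rightarrow> complex^'n \<Rightarrow> complex" where
  "rowdot w z = (\<Sum>j\<in>UNIV. w $ j * z $ j)"

lemma rowdot_matrix: "rowdot w (A *v z) = rowdot (w v* A) z"
  unfolding rowdot_def matrix_vector_mult_def vector_matrix_mult_def
  by (simp add: sum_distrib_left sum_distrib_right mult.assoc) (rule sum.swap)

definition mode :: "complex^'n \<Rightarrow> int \<Rightarrow> (real^'n) L2 \<Rightarrow> complex" where
  "mode w n f = rowdot w (fourier_coeff f n)"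

lemma mode_add_left: "mode (v + w) n f = mode v n f + mode w n f"
  and mode_scale_left: "mode (c *s w) n f = c * mode w n f"
  by (simp_all add: mode_def rowdot_def algebra_simps sum.distrib sum_distrib_left)

definition l1 :: "complex^'n \<Rightarrow> real" where
  "l1 w = (\<Sum>j\<in>UNIV. cmod (w $ j))"

lemma l1_nonneg: "0 \<le> l1 w"
  by (simp add: l1_def sum_nonneg)

lemma fourier_coeff_bound: "cmod (fourier_coeff f n $ j) \<le> norm f"
proof -
  have "cmod (of_real (f \<bullet> cos_mode n j) - \<i> * of_real (f \<bullet> sin_mode n j)) \<le> \<bar>f \<bullet> cos_mode n j\<bar> + \<bar>f \<bullet> sin_mode n j\<bar>"
    by (rule order_trans[OF norm_triangle_ineq4]) (simp add: norm_mult)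
  also have "\<dots> \<le> norm f * pi + norm f * pi"
    by (intro add_mono order_trans[OF Cauchy_Schwarz_ineq2] mult_left_mono norm_trig_modes norm_ge_zero)
  finally show ?thesis
    by (simp add: fourier_coeff_inner norm_divide norm_mult field_simps)
qed

text \<open>That this bound does not depend on \<open>n\<close> is essential for all estimates in \<open>1 / n\<close>.\<close>

lemma mode_bound: "cmod (mode w n f) \<le> l1 w * norm f"
  unfolding l1_def mode_def rowdot_def sum_distrib_right
  by (intro order_trans[OF norm_sum] sum_mono) (auto simp: norm_mult intro!: mult_left_mono fourier_coeff_bound)

lemma bounded_linear_mode: "bounded_linear (mode w n)"
proof
  show "mode w n (f + g) = mode w n f + mode w n g" for f g
    unfolding mode_def rowdot_def sum.distrib[symmetric] fourier_coeff_inner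
    by (intro sum.cong refl) (simp add: inner_add_left algebra_simps add_divide_distrib diff_divide_distrib)
  show "mode w n (c *\<^sub>R f) = c *\<^sub>R mode w n f" for c f
    unfolding mode_def rowdot_def scaleR_sum_right fourier_coeff_inner
    by (intro sum.cong refl) (simp add: scaleR_conv_of_real algebra_simps)
  show "\<exists>K. \<forall>f. cmod (mode w n f) \<le> norm f * K"
    using mode_bound[of w n] by (metis mult.commute)
qed

lemma L2_map_L2_class:
  assumes "bounded_linear T" "square_integrable f"
  shows "L2_map T (L2_class f) = L2_class (\<lambda>x. T (f x))"
  using assms by transfer (auto simp: square_integrable_linear)

lemma fourier_coeff_L2_map:
  fixes A :: "real^'n^'m"
  shows "fourier_coeff (L2_map ((*v) A) f) n = complex_matrix A *v fourier_coeff f n"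
proof -
  obtain g where g: "square_integrable g" "f = L2_class g" by (rule L2_class_cases)
  have bl: "bounded_linear ((*v) A)" by (rule matrix_vector_mul_bounded_linear)
  have inner: "L2_map ((*v) A) f \<bullet> L2_class (\<lambda>x. h x *\<^sub>R axis i 1)
      = (\<Sum>j\<in>UNIV. A $ i $ j * (f \<bullet> L2_class (\<lambda>x. h x *\<^sub>R axis j 1)))"
    if h: "\<And>i. square_integrable (\<lambda>x. h x *\<^sub>R axis i 1 :: real^'m)" "\<And>j. square_integrable (\<lambda>x. h x *\<^sub>R axis j 1 :: real^'n)"
    for h i
  proof -
    have int: "integrable circle (\<lambda>x. g x $ j * h x)" for j
      using integrable_inner[OF g(1) h(2)[of j]] by (simp add: inner_axis mult.commute)
    have "L2_map ((*v) A) f \<bullet> L2_class (\<lambda>x. h x *\<^sub>R axis i 1) = (\<integral>x. (A *v g x) $ i * h x \<partial>circle)"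
      unfolding g(2) L2_map_L2_class[OF bl g(1)]
      by (subst inner_L2_class[OF square_integrable_linear[OF bl g(1)] h(1)]) (simp add: inner_axis mult.commute)
    also have "\<dots> = (\<integral>x. (\<Sum>j\<in>UNIV. A $ i $ j * (g x $ j * h x)) \<partial>circle)"
      by (simp add: matrix_vector_mult_def sum_distrib_right mult.assoc)
    also have "\<dots> = (\<Sum>j\<in>UNIV. A $ i $ j * (\<integral>x. g x $ j * h x \<partial>circle))"
      using int by (subst Bochner_Integration.integral_sum) auto
    also have "\<dots> = (\<Sum>j\<in>UNIV. A $ i $ j * (f \<bullet> L2_class (\<lambda>x. h x *\<^sub>R axis j 1)))"
      unfolding g(2) by (simp add: inner_L2_class[OF g(1) h(2)] inner_axis mult.commute)
    finally show ?thesis .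
  qed
  have "fourier_coeff (L2_map ((*v) A) f) n $ i = (complex_matrix A *v fourier_coeff f n) $ i" for i
  proof -
    have "(complex_matrix A *v fourier_coeff f n) $ i = (\<Sum>j\<in>UNIV. of_real (A $ i $ j) * fourier_coeff f n $ j)"
      by (simp add: matrix_vector_mult_def complex_matrix_def)
    then show ?thesis
      unfolding fourier_coeff_inner cos_mode_def sin_mode_def
        inner[OF square_integrable_trig(1) square_integrable_trig(1)]
        inner[OF square_integrable_trig(2) square_integrable_trig(2)]
      by (simp add: sum_divide_distrib diff_divide_distrib sum_subtractf sum_distrib_left
          right_diff_distrib mult.left_commute)
  qed
  then show ?thesis by (simp add: vec_eq_iff)
qed

lemma periodic_smooth_trig:
  "periodic_smooth (\<lambda>x. cos (of_int n * x))" "periodic_smooth (\<lambda>x. sin (of_int n * x))"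
proof -
  define F where "F a b x = a * cos (of_int n * x) + b * sin (of_int n * x)" for a b x :: real
  have DF: "(F a b has_real_derivative F (b * of_int n) (- (a * of_int n)) x) (at x)" for a b x
    unfolding F_def by (auto intro!: derivative_eq_intros)
  have dF: "deriv (F a b) = F (b * of_int n) (- (a * of_int n))" for a b
    by (rule ext) (rule DERIV_imp_deriv[OF DF])
  have "\<exists>a' b'. (deriv ^^ k) (F a b) = F a' b'" for k a b
  proof (induction k)
    case (Suc k)
    then obtain a' b' where "(deriv ^^ k) (F a b) = F a' b'" by blast
    then have "(deriv ^^ Suc k) (F a b) = F (b' * of_int n) (- (a' * of_int n))" by (simp add: dF)
    then show ?case by blast
  qed auto
  then have diff: "(deriv ^^ k) (F a b) differentiable (at x)" for k a b x
    by (metis DF real_differentiable_def)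
  have per: "F a b (x + 2 * pi) = F a b x" for a b x
  proof -
    have "of_int n * (x + 2 * pi) = of_int n * x + 2 * pi * of_int n" by (simp add: algebra_simps)
    then show ?thesis unfolding F_def by (simp only: cos_add sin_add cos_int_2pin sin_int_2pin) simp
  qed
  have "periodic_smooth (F a b)" for a b
    unfolding periodic_smooth_def using diff per by blast
  from this[of 1 0] this[of 0 1]
  show "periodic_smooth (\<lambda>x. cos (of_int n * x))" "periodic_smooth (\<lambda>x. sin (of_int n * x))"
    by (simp_all add: F_def[abs_def])
qed

text \<open>The weak derivative is tested against \<open>cos (n x)\<close> and \<open>sin (n x)\<close>.\<close>

lemma fourier_coeff_weak_deriv:
  assumes "has_weak_deriv (component f i) (component g i)"
  shows "fourier_coeff g n $ i = \<i> * of_int n * fourier_coeff f n $ i"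
proof -
  have dc: "deriv (\<lambda>x. cos (of_int n * x)) = (\<lambda>x. - of_int n * sin (of_int n * x :: real))"
    and ds: "deriv (\<lambda>x. sin (of_int n * x)) = (\<lambda>x. of_int n * cos (of_int n * x :: real))"
    by (rule ext, rule DERIV_imp_deriv, auto intro!: derivative_eq_intros)+
  have "g \<bullet> cos_mode n i = of_int n * (f \<bullet> sin_mode n i)"
    using assms[unfolded has_weak_deriv_def, rule_format, OF periodic_smooth_trig(1)[of n]]
    unfolding inner_trig_modes dc by (simp add: mult.left_commute)
  moreover have "g \<bullet> sin_mode n i = - of_int n * (f \<bullet> cos_mode n i)"
    using assms[unfolded has_weak_deriv_def, rule_format, OF periodic_smooth_trig(2)[of n]]
    unfolding inner_trig_modes ds by (simp add: mult.left_commute)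
  ultimately show ?thesis
    by (simp add: fourier_coeff_inner algebra_simps)
qed

section \<open>The evolution of a Fourier mode\<close>

text \<open>The matrix by which the operator acts on the \<open>n\<close>-th Fourier coefficient.\<close>

definition symbol :: "real^'n^'n \<Rightarrow> real^'n^'n \<Rightarrow> real^'n^'n \<Rightarrow> int \<Rightarrow> complex^'n^'n" where
  "symbol B A K n = (\<chi> i j. (of_int n)\<^sup>2 * complex_matrix B $ i $ j
     + \<i> * of_int n * complex_matrix A $ i $ j + complex_matrix K $ i $ j)"

lemma row_symbol:
  "w v* symbol B A K n = (of_int n)\<^sup>2 *s (w v* complex_matrix B)
     + (\<i> * of_int n) *s (w v* complex_matrix A) + w v* complex_matrix K"
  by (simp add: symbol_def vector_matrix_mult_def vec_eq_iff algebra_simps sum.distrib sum_distrib_left)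

lemma symbol_vector:
  "symbol B A K n *v z = (of_int n)\<^sup>2 *s (complex_matrix B *v z)
     + (\<i> * of_int n) *s (complex_matrix A *v z) + complex_matrix K *v z"
  by (simp add: symbol_def matrix_vector_mult_def vec_eq_iff algebra_simps sum.distrib sum_distrib_left)

lemma fourier_coeff_linear:
  "fourier_coeff (f + g) n = fourier_coeff f n + fourier_coeff g n"
  "fourier_coeff (- f) n = - fourier_coeff f n"
  by (simp_all add: vec_eq_iff fourier_coeff_inner inner_add_left algebra_simps add_divide_distrib diff_divide_distrib)

text \<open>
  Only the parabolic entries of \<open>f2\<close> are second derivatives, but the hyperbolic columns of \<open>B\<close> are zero.
\<close>

lemma fourier_coeff_pt_graph:
  assumes B: "B = block_matrix 0 0 0 D" and fg: "(f, g) \<in> pt_graph B A K"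
  shows "fourier_coeff g n = symbol B A K n *v fourier_coeff f n"
proof -
  obtain f1 f2 where g: "g = - L2_map ((*v) B) f2 + L2_map ((*v) A) f1 + L2_map ((*v) K) f"
    and w1: "\<And>i. has_weak_deriv (component f i) (component f1 i)"
    and w2: "\<And>b. has_weak_deriv (component f1 (Inr b)) (component f2 (Inr b))"
    using fg unfolding pt_graph_def by blast
  have f1: "fourier_coeff f1 n = (\<i> * of_int n) *s fourier_coeff f n"
    by (simp add: vec_eq_iff fourier_coeff_weak_deriv[OF w1])
  have f2: "fourier_coeff f2 n $ Inr b = - ((of_int n)\<^sup>2 * fourier_coeff f n $ Inr b)" for b
  proof -
    have "\<i> * c * (\<i> * c * z) = - (c\<^sup>2 * z)" for c z
    proof -
      have "\<i> * c * (\<i> * c * z) = (\<i> * \<i>) * (c * c * z)" by (simp only: mult_ac)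
      then show ?thesis by (simp add: power2_eq_square)
    qed
    then show ?thesis
      by (simp add: fourier_coeff_weak_deriv[OF w2] fourier_coeff_weak_deriv[OF w1])
  qed
  have "complex_matrix B $ i $ j * fourier_coeff f2 n $ j
      = - ((of_int n)\<^sup>2 * (complex_matrix B $ i $ j * fourier_coeff f n $ j))" for i j
  proof (cases j)
    case (Inl a)
    then have "complex_matrix B $ i $ j = 0"
      by (cases i) (simp_all add: B block_matrix_def complex_matrix_def)
    then show ?thesis by simp
  qed (simp add: f2)
  then have "complex_matrix B *v fourier_coeff f2 n = - ((of_int n)\<^sup>2 *s (complex_matrix B *v fourier_coeff f n))"
    by (simp add: matrix_vector_mult_def vec_eq_iff sum_negf sum_distrib_left)
  then show ?thesis
    unfolding g fourier_coeff_linear fourier_coeff_L2_map f1 symbol_vector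
    by (simp add: vector_scalar_commute)
qed

text \<open>
  The relation between the two coefficients is closed in \<open>L\<^sup>2 \<times> L\<^sup>2\<close>, so it passes from the graph of the
  differential operator to its closure, which is the generator.
\<close>

lemma mode_generator:
  assumes B: "B = block_matrix 0 0 0 D" and S: "pt_semigroup B A K S" and FH: "(F, H) \<in> generator_graph S"
  shows "mode w n H = - mode (w v* symbol B A K n) n F"
proof -
  let ?C = "{p. mode w n (snd p) = - mode (w v* symbol B A K n) n (fst p)}"
  have cont: "continuous_on UNIV (mode v n)" for v
    by (rule linear_continuous_on[OF bounded_linear_mode])
  have "closed ?C"
    by (intro closed_Collect_eq continuous_on_minus continuous_on_compose2[OF cont] continuous_intros) auto
  moreover have "{(f, - g) | f g. (f, g) \<in> pt_graph B A K} \<subseteq> ?C"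
    by (auto simp: mode_def fourier_coeff_pt_graph[OF B] fourier_coeff_linear rowdot_matrix[symmetric])
      (simp add: rowdot_def sum_negf)
  ultimately have "closure {(f, - g) | f g. (f, g) \<in> pt_graph B A K} \<subseteq> ?C"
    by (intro closure_minimal)
  then show ?thesis using FH S unfolding pt_semigroup_def by auto
qed

text \<open>
  The integral of the orbit lies in the domain of the generator for every \<open>f\<close>, which gives an integral
  equation for the Fourier coefficient; its right-hand side is differentiable.
\<close>

lemma mode_has_vector_derivative:
  assumes B: "B = block_matrix 0 0 0 D" and S: "pt_semigroup B A K S" and t: "t \<in> {0..T}"
  shows "((\<lambda>t. mode w n (S t f)) has_vector_derivative - mode (w v* symbol B A K n) n (S t f)) (at t within {0..T})"
proof -
  have C0: "C0_semigroup S" using S by (simp add: pt_semigroup_def)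
  let ?w = "w v* symbol B A K n"
  have cont: "continuous_on {0..T} (\<lambda>s. S s f)" for T
    by (rule C0_semigroup_continuous_on[OF C0])
  have eq: "mode w n (S r f) = mode w n f - integral {0..r} (\<lambda>s. mode ?w n (S s f))" if "r \<in> {0..T}" for r
  proof -
    have "mode w n (S r f - f) = - mode ?w n (integral {0..r} (\<lambda>s. S s f))"
      using that by (intro mode_generator[OF B S] C0_semigroup_integral_generator[OF C0]) auto
    moreover have "mode ?w n (integral {0..r} (\<lambda>s. S s f)) = integral {0..r} (\<lambda>s. mode ?w n (S s f))"
      using integral_linear[OF integrable_continuous_interval[OF cont[of r]] bounded_linear_mode[of ?w n]]
      by (simp add: o_def)
    ultimately show ?thesis
      using bounded_linear_mode[of w n] by (simp add: linear_simps algebra_simps)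
  qed
  have "continuous_on {0..T} (\<lambda>s. mode ?w n (S s f))"
    by (rule bounded_linear.continuous_on[OF bounded_linear_mode cont])
  then have "((\<lambda>r. integral {0..r} (\<lambda>s. mode ?w n (S s f))) has_vector_derivative mode ?w n (S t f)) (at t within {0..T})"
    by (intro integral_has_vector_derivative t)
  then have "((\<lambda>r. mode w n f - integral {0..r} (\<lambda>s. mode ?w n (S s f))) has_vector_derivative - mode ?w n (S t f)) (at t within {0..T})"
    by (auto intro!: derivative_eq_intros)
  then show ?thesis
    by (rule has_vector_derivative_transform_within[OF _ zero_less_one t]) (simp add: eq)
qed

text \<open>
  For an exact left eigenvector the function \<open>\<psi>\<close> of the proof would be constant. In general its
  derivative is the pairing of the remainder \<open>r\<close> with the orbit, up to a bounded factor, and the orbit is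
  bounded by the semigroup estimate whatever the frequency.
\<close>

lemma mode_approx_eigenvector:
  assumes B: "B = block_matrix 0 0 0 D" and S: "pt_semigroup B A K S"
    and bound: "\<And>t f. t \<in> {0..T} \<Longrightarrow> norm (S t f) \<le> C * norm f"
    and w: "w v* symbol B A K n = \<sigma> *s w + r" and t: "t \<in> {0..T}"
  shows "cmod (mode w n (S t f) - exp (- \<sigma> * of_real t) * mode w n f)
    \<le> T * (exp (\<bar>Re \<sigma>\<bar> * T) * l1 r * C) * norm f"
proof -
  define \<psi> where "\<psi> s = exp (- \<sigma> * of_real (t - s)) * mode w n (S s f)" for s
  define b where "b = exp (\<bar>Re \<sigma>\<bar> * T) * l1 r * C * norm f"
  have E: "((\<lambda>s. exp (- \<sigma> * of_real (t - s))) has_vector_derivative \<sigma> * exp (- \<sigma> * of_real (t - s))) (at s within X)" for s X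
  proof -
    have "((\<lambda>z. exp (- \<sigma> * (of_real t - z))) has_field_derivative \<sigma> * exp (- \<sigma> * (of_real t - of_real s))) (at (of_real s))"
      by (auto intro!: derivative_eq_intros)
    from has_vector_derivative_real_field[OF this] show ?thesis by simp
  qed
  have der: "(\<psi> has_vector_derivative - (exp (- \<sigma> * of_real (t - s)) * mode r n (S s f))) (at s within {0..t})"
    if s: "s \<in> {0..t}" for s
  proof -
    have "((\<lambda>t. mode w n (S t f)) has_vector_derivative - (\<sigma> * mode w n (S s f) + mode r n (S s f))) (at s within {0..t})"
      using mode_has_vector_derivative[OF B S s, of w n f] unfolding w mode_add_left mode_scale_left .
    from has_vector_derivative_mult[OF E this] show ?thesis
      unfolding \<psi>_def by (simp add: algebra_simps)
  qed
  have bnd: "cmod (- (exp (- \<sigma> * of_real (t - s)) * mode r n (S s f))) \<le> b" if s: "s \<in> {0..t}" for s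
  proof -
    have "- Re \<sigma> * (t - s) \<le> \<bar>Re \<sigma>\<bar> * T"
      by (rule order_trans[OF mult_right_mono mult_left_mono]) (use s t in auto)
    then have "cmod (exp (- \<sigma> * of_real (t - s))) \<le> exp (\<bar>Re \<sigma>\<bar> * T)"
      by (simp add: norm_exp_eq_Re)
    moreover have "cmod (mode r n (S s f)) \<le> l1 r * (C * norm f)"
      by (rule order_trans[OF mode_bound mult_left_mono]) (use s t bound in \<open>auto simp: l1_nonneg\<close>)
    ultimately have "cmod (exp (- \<sigma> * of_real (t - s))) * cmod (mode r n (S s f))
        \<le> exp (\<bar>Re \<sigma>\<bar> * T) * (l1 r * (C * norm f))"
      by (intro mult_mono) auto
    then show ?thesis by (simp add: norm_mult b_def mult.assoc)
  qed
  have "norm (\<psi> t - \<psi> 0) \<le> b * norm (t - 0)"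
  proof (rule differentiable_bound[of "{0..t}"])
    show "(\<psi> has_derivative (\<lambda>h. h *\<^sub>R - (exp (- \<sigma> * of_real (t - s)) * mode r n (S s f)))) (at s within {0..t})"
      if "s \<in> {0..t}" for s
      using der[OF that] unfolding has_vector_derivative_def .
    show "onorm (\<lambda>h. h *\<^sub>R - (exp (- \<sigma> * of_real (t - s)) * mode r n (S s f))) \<le> b" if "s \<in> {0..t}" for s
      by (rule onorm_le) (use mult_left_mono[OF bnd[OF that] abs_ge_zero] in \<open>simp add: mult.commute\<close>)
  qed (use t in auto)
  also have "\<dots> \<le> b * T"
    using t order_trans[OF norm_ge_zero bnd[of 0]] by (intro mult_left_mono) auto
  finally have "norm (\<psi> t - \<psi> 0) \<le> b * T" .
  moreover have "S 0 = id" using S unfolding pt_semigroup_def C0_semigroup_def by blast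
  ultimately show ?thesis
    by (simp add: \<psi>_def b_def mult_ac)
qed

section \<open>A lacunary series\<close>

lemma circle_integral_FTC:
  fixes F f :: "real \<Rightarrow> real"
  assumes F: "\<And>x. (F has_real_derivative f x) (at x)" and f: "continuous_on UNIV f"
  shows "(\<integral>x. f x \<partial>circle) = F (2 * pi) - F 0"
proof -
  have [measurable]: "f \<in> borel_measurable borel" using f by (rule borel_measurable_continuous_onI)
  have "(\<integral>x. f x \<partial>circle) = (\<integral>x. indicator {0..<2 * pi} x *\<^sub>R f x \<partial>lborel)"
    unfolding circle_def by (rule integral_restrict_space) simp
  also have "\<dots> = (\<integral>x. f x * indicator {0..2 * pi} x \<partial>lborel)"
  proof (rule integral_cong_AE)
    show "AE x in lborel. indicator {0..<2 * pi} x *\<^sub>R f x = f x * indicator {0..2 * pi} x"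
      using AE_lborel_singleton[of "2 * pi"] by eventually_elim (auto simp: indicator_def)
  qed auto
  also have "\<dots> = F (2 * pi) - F 0"
    using F f by (intro integral_FTC_Icc_real) (auto simp: continuous_on_eq_continuous_at)
  finally show ?thesis .
qed

lemma circle_integral_cos: "(\<integral>x. cos (of_int n * x) \<partial>circle) = (if n = 0 then 2 * pi else 0)"
proof (cases "n = 0")
  case True
  then show ?thesis by (simp add: space_circle circle_def measure_restrict_space)
next
  case False
  have "(\<integral>x. cos (of_int n * x) \<partial>circle) = sin (of_int n * (2 * pi)) / of_int n - sin (of_int n * 0) / of_int n"
    using False by (intro circle_integral_FTC continuous_intros) (auto intro!: derivative_eq_intros)
  then show ?thesis using False by (simp add: mult.commute[of "of_int n"])
qed

lemma circle_integral_sin: "(\<integral>x. sin (of_int n * x) \<partial>circle) = 0"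
proof (cases "n = 0")
  case False
  have "(\<integral>x. sin (of_int n * x) \<partial>circle) = - cos (of_int n * (2 * pi)) / of_int n - - cos (of_int n * 0) / of_int n"
    using False by (intro circle_integral_FTC continuous_intros) (auto intro!: derivative_eq_intros)
  then show ?thesis using False by (simp add: mult.commute[of "of_int n"])
qed simp

lemma integrable_circle_continuous:
  fixes f :: "real \<Rightarrow> real"
  assumes "continuous_on UNIV f" "\<And>x. \<bar>f x\<bar> \<le> 1"
  shows "integrable circle f"
  using assms by (intro circle.integrable_const_bound[where B = 1] borel_measurable_circleI
      borel_measurable_continuous_onI) auto

lemma circle_integral_products:
  assumes nz: "n + m \<noteq> 0"
  shows "(\<integral>x. cos (of_int n * x) * cos (of_int m * x) \<partial>circle) = (if n = m then pi else 0)"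
    and "(\<integral>x. sin (of_int n * x) * sin (of_int m * x) \<partial>circle) = (if n = m then pi else 0)"
    and "(\<integral>x. cos (of_int n * x) * sin (of_int m * x) \<partial>circle) = 0"
    and "(\<integral>x. sin (of_int n * x) * cos (of_int m * x) \<partial>circle) = 0"
proof -
  have c: "integrable circle (\<lambda>x. cos (of_int k * x))" and s: "integrable circle (\<lambda>x. sin (of_int k * x))" for k
    by (intro integrable_circle_continuous continuous_intros; simp)+
  note ints = c[of "n - m"] c[of "n + m"] s[of "n - m"] s[of "n + m"]
  have d: "of_int n * x - of_int m * x = of_int (n - m) * x" "of_int n * x + of_int m * x = of_int (n + m) * x" for x :: real
    by (simp_all add: algebra_simps)
  show "(\<integral>x. cos (of_int n * x) * cos (of_int m * x) \<partial>circle) = (if n = m then pi else 0)"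
    unfolding cos_times_cos d
    using ints nz by (simp add: circle_integral_cos del: of_int_diff of_int_add)
  show "(\<integral>x. sin (of_int n * x) * sin (of_int m * x) \<partial>circle) = (if n = m then pi else 0)"
    unfolding sin_times_sin d
    using ints nz by (simp add: circle_integral_cos del: of_int_diff of_int_add)
  show "(\<integral>x. cos (of_int n * x) * sin (of_int m * x) \<partial>circle) = 0"
    unfolding cos_times_sin d
    using ints by (simp add: circle_integral_sin del: of_int_diff of_int_add)
  show "(\<integral>x. sin (of_int n * x) * cos (of_int m * x) \<partial>circle) = 0"
    unfolding sin_times_cos d
    using ints by (simp add: circle_integral_sin del: of_int_diff of_int_add)
qed

text \<open>The frequency \<open>- m\<close> is excluded, because the real modes of frequency \<open>m\<close> contain it as well.\<close>

lemma mode_trig_modes: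
  assumes "n = m \<or> \<bar>n\<bar> \<noteq> \<bar>m\<bar>" "m \<noteq> 0"
  shows "mode w n (cos_mode m j) = (if n = m then w $ j / 2 else 0)"
    and "mode w n (sin_mode m j) = (if n = m then - \<i> * w $ j / 2 else 0)"
proof -
  have nz: "n + m \<noteq> 0" using assms by auto
  have ax: "axis j 1 \<bullet> (axis i 1 :: real^'a) = (if i = j then 1 else 0)" for i j
    by (simp add: inner_axis_axis)
  note inner = inner_L2_class[OF square_integrable_trig(1) square_integrable_trig(1)]
    inner_L2_class[OF square_integrable_trig(1) square_integrable_trig(2)]
    inner_L2_class[OF square_integrable_trig(2) square_integrable_trig(1)]
    inner_L2_class[OF square_integrable_trig(2) square_integrable_trig(2)]
  have "fourier_coeff (cos_mode m j) n $ i = (if i = j then if n = m then 1 / 2 else 0 else 0)" for i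
    unfolding fourier_coeff_inner cos_mode_def sin_mode_def inner
    by (simp add: ax circle_integral_products[OF nz])
  then show "mode w n (cos_mode m j) = (if n = m then w $ j / 2 else 0)"
    by (simp add: mode_def rowdot_def if_distrib cong: if_cong)
  have "fourier_coeff (sin_mode m j) n $ i = (if i = j then if n = m then - \<i> / 2 else 0 else 0)" for i
    unfolding fourier_coeff_inner cos_mode_def sin_mode_def inner
    by (simp add: ax circle_integral_products[OF nz])
  then show "mode w n (sin_mode m j) = (if n = m then - \<i> * w $ j / 2 else 0)"
    by (simp add: mode_def rowdot_def if_distrib mult.commute cong: if_cong)
qed

text \<open>
  The function is the sum of \<open>2\<^sup>-\<^sup>k Re (e\<^sup>i\<^sup>\<nu>\<^sup>x z)\<close> over \<open>k\<close>, with \<open>\<nu> = \<nu> k\<close> and with \<open>z\<close> the conjugate of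
  \<open>W\<close>. The series converges in norm in the Banach space \<open>L\<^sup>2\<close>, so its coefficients can be computed term
  by term. The factor \<open>1 / 2\<close> is that of \<open>Re z = (z + cnj z) / 2\<close>.
\<close>

lemma lacunary_series_exists:
  fixes W :: "complex^'n" and \<nu> :: "nat \<Rightarrow> int"
  assumes \<nu>: "inj \<nu>" "\<And>k. \<nu> k > int N"
  shows "\<exists>f. (\<forall>n. \<bar>n\<bar> \<le> int N \<longrightarrow> fourier_coeff f n = 0)
    \<and> (\<forall>k w. mode w (\<nu> k) f = (1 / 2) ^ k * (rowdot w (\<chi> j. cnj (W $ j)) / 2))"
proof -
  define E where "E k = (\<Sum>j\<in>UNIV. Re (W $ j) *\<^sub>R cos_mode (\<nu> k) j + Im (W $ j) *\<^sub>R sin_mode (\<nu> k) j)" for k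
  define b where "b = (\<Sum>j\<in>UNIV. \<bar>Re (W $ j)\<bar> * pi + \<bar>Im (W $ j)\<bar> * pi)"
  have "norm (E k) \<le> b" for k
    unfolding E_def b_def
    by (intro order_trans[OF norm_sum] sum_mono order_trans[OF norm_triangle_ineq] add_mono)
      (simp_all add: mult_left_mono norm_trig_modes)
  then have le: "norm ((1 / 2) ^ k *\<^sub>R E k) \<le> (1 / 2) ^ k * b" for k
    by (simp add: mult_left_mono)
  have "summable (\<lambda>k. (1 / 2 :: real) ^ k * b)"
    by (intro summable_mult2 summable_geometric) simp
  then have sum_E: "summable (\<lambda>k. (1 / 2) ^ k *\<^sub>R E k)"
    by (rule summable_comparison_test'[OF _ le])
  define f where "f = (\<Sum>k. (1 / 2) ^ k *\<^sub>R E k)"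
  have mode_E: "mode w n (E k) = (if n = \<nu> k then rowdot w (\<chi> j. cnj (W $ j)) / 2 else 0)"
    if "n = \<nu> k \<or> \<bar>n\<bar> \<noteq> \<bar>\<nu> k\<bar>" for w n k
  proof -
    interpret bounded_linear "mode w n" by (rule bounded_linear_mode)
    have "\<nu> k \<noteq> 0" using \<nu>(2)[of k] by auto
    note trig = mode_trig_modes[OF that this]
    have cnj: "cnj z = of_real (Re z) - \<i> * of_real (Im z)" for z by (simp add: complex_eq_iff)
    show ?thesis
      unfolding E_def sum add scaleR trig rowdot_def
      by (simp add: scaleR_conv_of_real cnj sum_divide_distrib algebra_simps add_divide_distrib diff_divide_distrib)
  qed
  have mode_f: "mode w n f = (\<Sum>k. (1 / 2) ^ k *\<^sub>R mode w n (E k))" for w n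
  proof -
    interpret bounded_linear "mode w n" by (rule bounded_linear_mode)
    show ?thesis unfolding f_def suminf[OF sum_E] by (simp only: scaleR)
  qed
  have "mode w (\<nu> k) f = (1 / 2) ^ k * (rowdot w (\<chi> j. cnj (W $ j)) / 2)" for k w
  proof -
    have "mode w (\<nu> k) (E l) = (if l = k then rowdot w (\<chi> j. cnj (W $ j)) / 2 else 0)" for l
      using \<nu>(2)[of k] \<nu>(2)[of l] by (subst mode_E) (auto simp: inj_eq[OF \<nu>(1)])
    note E = this
    then have "mode w (\<nu> k) f = (\<Sum>l\<in>{k}. (1 / 2) ^ l *\<^sub>R mode w (\<nu> k) (E l))"
      unfolding mode_f by (intro suminf_finite) auto
    also have "\<dots> = (1 / 2) ^ k * (rowdot w (\<chi> j. cnj (W $ j)) / 2)"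
      by (simp add: E scaleR_conv_of_real)
    finally show ?thesis .
  qed
  moreover have "fourier_coeff f n = 0" if n: "\<bar>n\<bar> \<le> int N" for n
  proof -
    have "mode w n (E l) = 0" for w l
      using \<nu>(2)[of l] n by (subst mode_E) auto
    then have "mode (axis j 1) n f = 0" for j
      unfolding mode_f by simp
    moreover have "mode (axis j 1) n f = fourier_coeff f n $ j" for j
      by (simp add: mode_def rowdot_def axis_def mult_delta_left)
    ultimately show ?thesis by (simp add: vec_eq_iff)
  qed
  ultimately show ?thesis by blast
qed

section \<open>Steering a high frequency\<close>

text \<open>
  Fubini's theorem. The squared norms of the slices are integrable in time, and \<open>a \<le> 1 + a\<^sup>2\<close> gives an
  integrable bound for the norms themselves.
\<close>

lemma control_slices:
  fixes u :: "real \<Rightarrow> real \<Rightarrow> real^'m"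
  assumes u: "L2_control T \<omega> u" and \<omega>: "open_torus \<omega>"
  shows "\<exists>\<rho>. integrable (restrict_space lborel {0<..<T}) \<rho> \<and>
    (AE s in restrict_space lborel {0<..<T}. square_integrable (\<lambda>x. indicator \<omega> x *\<^sub>R u s x)
       \<and> norm (L2_class (\<lambda>x. indicator \<omega> x *\<^sub>R u s x)) \<le> \<rho> s)"
proof -
  define Q where "Q = {0<..<T} \<times> (\<omega> \<inter> {0..<2 * pi})"
  define G where "G = (\<lambda>p. indicator Q p *\<^sub>R u (fst p) (snd p))"
  define I where "I = (\<lambda>p. indicator Q p * (norm (u (fst p) (snd p)))\<^sup>2)"
  have G: "G \<in> borel_measurable (lborel \<Otimes>\<^sub>M lborel)"
    using u unfolding L2_control_def Let_def set_borel_measurable_def Q_def[symmetric] G_def lborel_prod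
    by (simp add: case_prod_beta')
  have I: "integrable (lborel \<Otimes>\<^sub>M lborel) I"
    using u unfolding L2_control_def Let_def set_integrable_def Q_def[symmetric] I_def lborel_prod
    by (simp add: case_prod_beta')
  define J where "J s = (\<integral>x. I (s, x) \<partial>lborel)" for s
  have J: "integrable lborel J"
    unfolding J_def by (rule lborel_pair.integrable_fst'[OF I])
  have slice: "square_integrable (\<lambda>x. indicator \<omega> x *\<^sub>R u s x) \<and>
      norm (L2_class (\<lambda>x. indicator \<omega> x *\<^sub>R u s x)) \<le> 1 + J s"
    if s: "s \<in> {0<..<T}" and int: "integrable lborel (\<lambda>x. I (s, x))" for s
  proof -
    let ?h = "\<lambda>x. indicator \<omega> x *\<^sub>R u s x"
    have "(\<lambda>x. G (s, x)) \<in> borel_measurable lborel"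
      by (rule measurable_compose[OF measurable_Pair1' G]) simp
    moreover have "(\<lambda>x. G (s, x)) = (\<lambda>x. indicator {0..<2 * pi} x *\<^sub>R ?h x)"
      using s by (auto simp: G_def Q_def indicator_def)
    ultimately have meas: "?h \<in> borel_measurable circle"
      unfolding circle_def by (subst borel_measurable_restrict_space_iff) auto
    have I_eq: "(\<lambda>x. I (s, x)) = (\<lambda>x. indicator {0..<2 * pi} x *\<^sub>R (norm (?h x))\<^sup>2)"
      using s by (auto simp: I_def Q_def indicator_def)
    have "integrable circle (\<lambda>x. (norm (?h x))\<^sup>2)"
      unfolding circle_def using int by (subst integrable_restrict_space) (auto simp: I_eq)
    then have h: "square_integrable ?h" using meas by (simp add: square_integrable_def)
    have "(\<integral>x. (norm (?h x))\<^sup>2 \<partial>circle) = J s"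
      unfolding circle_def J_def I_eq by (rule integral_restrict_space) simp
    then have "(norm (L2_class ?h))\<^sup>2 = J s" using norm_L2_class[OF h] by simp
    moreover have "2 * norm (L2_class ?h) \<le> 1 + (norm (L2_class ?h))\<^sup>2"
      using zero_le_power2[of "norm (L2_class ?h) - 1"] by (simp add: power2_diff)
    ultimately have "norm (L2_class ?h) \<le> 1 + J s"
      using norm_ge_zero[of "L2_class ?h"] by linarith
    with h show ?thesis ..
  qed
  have "AE s in lborel. integrable lborel (\<lambda>x. I (s, x))"
    by (rule lborel_pair.AE_integrable_fst'[OF I])
  then have "AE s in lborel. s \<in> {0<..<T} \<longrightarrow> square_integrable (\<lambda>x. indicator \<omega> x *\<^sub>R u s x)
      \<and> norm (L2_class (\<lambda>x. indicator \<omega> x *\<^sub>R u s x)) \<le> 1 + J s"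
    by eventually_elim (use slice in blast)
  then have "AE s in restrict_space lborel {0<..<T}. square_integrable (\<lambda>x. indicator \<omega> x *\<^sub>R u s x)
      \<and> norm (L2_class (\<lambda>x. indicator \<omega> x *\<^sub>R u s x)) \<le> 1 + J s"
    by (subst AE_restrict_space_iff) auto
  moreover have "integrable (restrict_space lborel {0<..<T}) (\<lambda>s. 1 + J s)"
  proof -
    have "integrable lborel (\<lambda>s. indicator {0<..<T} s *\<^sub>R J s)"
      by (rule integrable_mult_indicator[OF _ J]) simp
    moreover have "integrable lborel (indicator {0<..<T} :: real \<Rightarrow> real)"
      using emeasure_bounded_finite[OF bounded_subset[OF bounded_closed_interval greaterThanLessThan_subseteq_atLeastAtMost_iff[THEN iffD2]], of 0 T 0 T]
      by (intro integrable_real_indicator) auto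
    ultimately have "integrable lborel (\<lambda>s. indicator {0<..<T} s + indicator {0<..<T} s *\<^sub>R J s)"
      by (rule Bochner_Integration.integrable_add[rotated])
    then have "integrable lborel (\<lambda>s. indicator {0<..<T} s *\<^sub>R (1 + J s))"
      by (simp add: distrib_left)
    then show ?thesis by (subst integrable_restrict_space) auto
  qed
  ultimately show ?thesis by blast
qed

lemma norm_L2_map_le:
  fixes A :: "real^'n^'m"
  shows "\<exists>C\<ge>0. \<forall>f. norm (L2_map ((*v) A) f) \<le> C * norm f"
proof -
  have bl: "bounded_linear ((*v) A)" by (rule matrix_vector_mul_bounded_linear)
  obtain C where C: "C > 0" "\<And>x. norm (A *v x) \<le> norm x * C"
    using bounded_linear.pos_bounded[OF bl] by blast
  have "norm (L2_map ((*v) A) f) \<le> C * norm f" for f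
  proof -
    obtain g where g: "square_integrable g" "f = L2_class g" by (rule L2_class_cases)
    have Ag: "square_integrable (\<lambda>x. A *v g x)" by (rule square_integrable_linear[OF bl g(1)])
    have "(norm (L2_map ((*v) A) f))\<^sup>2 = (\<integral>x. (norm (A *v g x))\<^sup>2 \<partial>circle)"
      unfolding g(2) L2_map_L2_class[OF bl g(1)] by (rule norm_L2_class[OF Ag])
    also have "\<dots> \<le> (\<integral>x. C\<^sup>2 * (norm (g x))\<^sup>2 \<partial>circle)"
    proof (rule integral_mono)
      show "(norm (A *v g x))\<^sup>2 \<le> C\<^sup>2 * (norm (g x))\<^sup>2" for x
        using power_mono[OF C(2)[of "g x"] norm_ge_zero, of 2] by (simp add: power_mult_distrib mult.commute)
    qed (use g(1) Ag in \<open>auto simp: square_integrable_def\<close>)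
    also have "\<dots> = (C * norm f)\<^sup>2"
      by (simp add: g(2) norm_L2_class[OF g(1)] power_mult_distrib)
    finally show ?thesis using C(1) by (simp add: power2_le_iff_abs_le)
  qed
  then show ?thesis using C(1) less_imp_le by blast
qed

lemma l1_expansion:
  assumes n: "n \<ge> (1 :: int)"
  shows "l1 ((1 / of_int n) *s X + (1 / (of_int n)\<^sup>2) *s Y) \<le> (l1 X + l1 Y) / of_int n"
proof -
  have "cmod (1 / of_int n * x + 1 / (of_int n)\<^sup>2 * y) \<le> (cmod x + cmod y) / of_int n" for x y :: complex
  proof -
    have "cmod (1 / of_int n * x + 1 / (of_int n)\<^sup>2 * y) \<le> cmod x / of_int n + cmod y / (of_int n)\<^sup>2"
      using n by (intro order_trans[OF norm_triangle_ineq]) (simp add: norm_mult norm_divide norm_power)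
    also have "cmod y / (of_int n)\<^sup>2 \<le> cmod y / of_int n"
      using n by (intro divide_left_mono) (auto simp: power2_eq_square)
    finally show ?thesis by (simp add: add_divide_distrib)
  qed
  then show ?thesis
    by (simp add: l1_def sum.distrib[symmetric] sum_divide_distrib sum_mono)
qed

definition expansion :: "complex^'n \<Rightarrow> complex^'n \<Rightarrow> complex^'n \<Rightarrow> int \<Rightarrow> complex^'n" where
  "expansion W0 W1 W2 n = W0 + ((1 / of_int n) *s W1 + (1 / (of_int n)\<^sup>2) *s W2)"

lemma expansion_matrix:
  "expansion W0 W1 W2 n v* X = expansion (W0 v* X) (W1 v* X) (W2 v* X) n"
  by (simp add: expansion_def vector_matrix_left_distrib scalar_vector_matrix_assoc)

text \<open>The three equations cancel the orders \<open>n\<^sup>2\<close>, \<open>n\<close> and \<open>1\<close>; only orders \<open>1 / n\<close> and \<open>1 / n\<^sup>2\<close> remain.\<close>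

lemma expansion_symbol:
  assumes 1: "W0 v* complex_matrix B = 0"
    and 2: "\<i> *s (W0 v* complex_matrix A - m *s W0) + W1 v* complex_matrix B = 0"
    and 3: "W0 v* complex_matrix K - l *s W0 + \<i> *s (W1 v* complex_matrix A - m *s W1) + W2 v* complex_matrix B = 0"
    and n: "n \<noteq> 0"
  shows "expansion W0 W1 W2 n v* symbol B A K n = (\<i> * of_int n * m + l) *s expansion W0 W1 W2 n
     + ((1 / of_int n) *s (W1 v* complex_matrix K - l *s W1 + \<i> *s (W2 v* complex_matrix A - m *s W2))
        + (1 / (of_int n)\<^sup>2) *s (W2 v* complex_matrix K - l *s W2))"
  unfolding row_symbol expansion_matrix vec_eq_iff
proof
  fix j
  define c :: complex where "c = of_int n"
  have c: "c \<noteq> 0" using n by (simp add: c_def)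
  define b1 b2 a0 a1 a2 k0 k1 k2 where defs:
    "b1 = (W1 v* complex_matrix B) $ j" "b2 = (W2 v* complex_matrix B) $ j"
    "a0 = (W0 v* complex_matrix A) $ j" "a1 = (W1 v* complex_matrix A) $ j" "a2 = (W2 v* complex_matrix A) $ j"
    "k0 = (W0 v* complex_matrix K) $ j" "k1 = (W1 v* complex_matrix K) $ j" "k2 = (W2 v* complex_matrix K) $ j"
  have b1: "b1 = - \<i> * (a0 - m * W0 $ j)"
    using arg_cong[OF 2, of "\<lambda>v. v $ j"] by (simp add: defs algebra_simps add_eq_0_iff)
  have b2: "b2 = l * W0 $ j - k0 - \<i> * (a1 - m * W1 $ j)"
    using arg_cong[OF 3, of "\<lambda>v. v $ j"] by (simp add: defs algebra_simps add_eq_0_iff)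
  have "c\<^sup>2 * (0 + (1 / c * b1 + 1 / c\<^sup>2 * b2)) + \<i> * c * (a0 + (1 / c * a1 + 1 / c\<^sup>2 * a2)) + (k0 + (1 / c * k1 + 1 / c\<^sup>2 * k2))
    = (\<i> * c * m + l) * (W0 $ j + (1 / c * W1 $ j + 1 / c\<^sup>2 * W2 $ j))
      + (1 / c * (k1 - l * W1 $ j + \<i> * (a2 - m * W2 $ j)) + 1 / c\<^sup>2 * (k2 - l * W2 $ j))"
    unfolding b1 b2 using c by (simp add: field_simps power2_eq_square)
  then show "((of_int n)\<^sup>2 *s expansion (W0 v* complex_matrix B) (W1 v* complex_matrix B) (W2 v* complex_matrix B) n
      + (\<i> * of_int n) *s expansion (W0 v* complex_matrix A) (W1 v* complex_matrix A) (W2 v* complex_matrix A) n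
      + expansion (W0 v* complex_matrix K) (W1 v* complex_matrix K) (W2 v* complex_matrix K) n) $ j
    = ((\<i> * of_int n * m + l) *s expansion W0 W1 W2 n
     + ((1 / of_int n) *s (W1 v* complex_matrix K - l *s W1 + \<i> *s (W2 v* complex_matrix A - m *s W2))
        + (1 / (of_int n)\<^sup>2) *s (W2 v* complex_matrix K - l *s W2))) $ j"
    by (simp only: expansion_def defs c_def 1 vector_add_component vector_minus_component vector_smult_component zero_index)
qed

text \<open>
  Pair Duhamel's formula for \<open>f T = 0\<close> with \<open>w n = W0 + W1 / n + W2 / n\<^sup>2\<close>. By the approximate eigenvector
  property, every term of the formula is a scalar exponential times a Fourier coefficient up to \<open>O(1 / n)\<close>.
  For the source the coefficient is that of the control paired with \<open>w n M\<close>, which is \<open>O(1 / n)\<close> because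
  \<open>W0 M = 0\<close>. As \<open>\<mu>\<close> is real, the exponentials have moduli independent of \<open>n\<close>.
\<close>

lemma steerable_mode_bound:
  fixes A B K :: "real^('h::finite + 'p::finite)^('h + 'p)" and M :: "real^'m^('h + 'p)"
    and \<mu> :: real
  assumes B: "B = block_matrix 0 0 0 D" and T: "T > 0" and \<omega>: "open_torus \<omega>"
    and 1: "W0 v* complex_matrix B = 0"
    and 2: "\<i> *s (W0 v* complex_matrix A - of_real \<mu> *s W0) + W1 v* complex_matrix B = 0"
    and 3: "W0 v* complex_matrix K - l *s W0 + \<i> *s (W1 v* complex_matrix A - of_real \<mu> *s W1) + W2 v* complex_matrix B = 0"
    and M: "W0 v* complex_matrix M = 0"
    and steer: "steerable_to_zero B A K M \<omega> T f0"
  shows "\<exists>C. \<forall>n\<ge>1. cmod (mode (expansion W0 W1 W2 n) n f0) \<le> C / of_int n"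
proof -
  obtain u f where u: "L2_control T \<omega> u" and f: "mild_solution B A K M \<omega> T f0 u f" and fT: "f T = 0"
    using steer unfolding steerable_to_zero_def by blast
  define h where "h s = L2_class (\<lambda>x. indicator \<omega> x *\<^sub>R u s x)" for s
  define g where "g s = L2_class (\<lambda>x. indicator \<omega> x *\<^sub>R (M *v u s x))" for s
  let ?I = "restrict_space lborel {0<..<T}"
  obtain S where S: "pt_semigroup B A K S"
    and "\<forall>t\<in>{0..T}. has_bochner_integral (restrict_space lborel {0<..<t}) (\<lambda>s. S (t - s) (g s)) (f t - S t f0)"
    using f unfolding mild_solution_def g_def by blast
  then have "has_bochner_integral ?I (\<lambda>s. S (T - s) (g s)) (f T - S T f0)"
    using T by simp
  then have int: "has_bochner_integral ?I (\<lambda>s. S (T - s) (g s)) (- S T f0)"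
    by (simp add: fT)
  obtain C where C: "C \<ge> 0" "\<And>t x. t \<in> {0..T} \<Longrightarrow> norm (S t x) \<le> C * norm x"
    using C0_semigroup_locally_bounded[of S T] S unfolding pt_semigroup_def by blast
  obtain \<kappa> where \<kappa>: "\<kappa> \<ge> 0" "\<And>f. norm (L2_map ((*v) M) f) \<le> \<kappa> * norm f"
    using norm_L2_map_le[of M] by blast
  obtain \<rho> where \<rho>: "integrable ?I \<rho>" and AE_\<rho>: "AE s in ?I. square_integrable (\<lambda>x. indicator \<omega> x *\<^sub>R u s x)
       \<and> norm (h s) \<le> \<rho> s"
    using control_slices[OF u \<omega>] unfolding h_def by blast
  define w where "w n = expansion W0 W1 W2 n" for n
  define \<sigma> where "\<sigma> n = \<i> * of_int n * of_real \<mu> + l" for n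
  have Re_\<sigma>: "Re (\<sigma> n) = Re l" for n by (simp add: \<sigma>_def)
  define R1 where "R1 = W1 v* complex_matrix K - l *s W1 + \<i> *s (W2 v* complex_matrix A - of_real \<mu> *s W2)"
  define R2 where "R2 = W2 v* complex_matrix K - l *s W2"
  define c1 where "c1 = T * (exp (\<bar>Re l\<bar> * T) * (l1 R1 + l1 R2) * C)"
  have c1: "c1 \<ge> 0" unfolding c1_def using T C(1) by (intro mult_nonneg_nonneg add_nonneg_nonneg l1_nonneg) auto
  have approx: "cmod (mode (w n) n (S t f) - exp (- \<sigma> n * of_real t) * mode (w n) n f) \<le> c1 / of_int n * norm f"
    if n: "n \<ge> 1" and t: "t \<in> {0..T}" for n t f
  proof -
    let ?r = "(1 / of_int n) *s R1 + (1 / (of_int n)\<^sup>2) *s R2"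
    have "w n v* symbol B A K n = \<sigma> n *s w n + ?r"
      unfolding w_def \<sigma>_def R1_def R2_def using n by (intro expansion_symbol 1 2 3) auto
    from mode_approx_eigenvector[OF B S C(2) this t, of f]
    have "cmod (mode (w n) n (S t f) - exp (- \<sigma> n * of_real t) * mode (w n) n f)
        \<le> T * (exp (\<bar>Re l\<bar> * T) * l1 ?r * C) * norm f"
      by (simp add: Re_\<sigma>)
    also have "\<dots> \<le> T * (exp (\<bar>Re l\<bar> * T) * ((l1 R1 + l1 R2) / of_int n) * C) * norm f"
      using T C(1) by (intro mult_right_mono mult_left_mono l1_expansion n) auto
    also have "\<dots> = c1 / of_int n * norm f" by (simp add: c1_def)
    finally show ?thesis .
  qed
  define c2 where "c2 = exp (\<bar>Re l\<bar> * T) * (l1 (W1 v* complex_matrix M) + l1 (W2 v* complex_matrix M)) + c1 * \<kappa>"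
  have source: "cmod (mode (w n) n (S (T - s) (g s))) \<le> c2 / of_int n * \<rho> s"
    if n: "n \<ge> 1" and s: "s \<in> {0<..<T}" and sq: "square_integrable (\<lambda>x. indicator \<omega> x *\<^sub>R u s x)"
      and hs: "norm (h s) \<le> \<rho> s" for n s
  proof -
    have g: "g s = L2_map ((*v) M) (h s)"
      unfolding g_def h_def L2_map_L2_class[OF matrix_vector_mul_bounded_linear sq]
      by (simp add: matrix_vector_mult_scaleR)
    have "w n v* complex_matrix M = (1 / of_int n) *s (W1 v* complex_matrix M) + (1 / (of_int n)\<^sup>2) *s (W2 v* complex_matrix M)"
      unfolding w_def expansion_matrix M by (simp add: expansion_def)
    then have "mode (w n) n (g s) = mode ((1 / of_int n) *s (W1 v* complex_matrix M) + (1 / (of_int n)\<^sup>2) *s (W2 v* complex_matrix M)) n (h s)"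
      by (simp add: g mode_def fourier_coeff_L2_map rowdot_matrix)
    then have "cmod (mode (w n) n (g s))
        \<le> l1 ((1 / of_int n) *s (W1 v* complex_matrix M) + (1 / (of_int n)\<^sup>2) *s (W2 v* complex_matrix M)) * norm (h s)"
      using mode_bound by metis
    also have "\<dots> \<le> (l1 (W1 v* complex_matrix M) + l1 (W2 v* complex_matrix M)) / of_int n * norm (h s)"
      by (intro mult_right_mono l1_expansion n) simp
    finally have m: "cmod (mode (w n) n (g s)) \<le> (l1 (W1 v* complex_matrix M) + l1 (W2 v* complex_matrix M)) / of_int n * norm (h s)" .
    have "- Re l * (T - s) \<le> \<bar>Re l\<bar> * T"
      by (rule order_trans[OF mult_right_mono mult_left_mono]) (use s in auto)
    then have "cmod (exp (- \<sigma> n * of_real (T - s))) \<le> exp (\<bar>Re l\<bar> * T)"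
      by (simp add: norm_exp_eq_Re Re_\<sigma>)
    then have m2: "cmod (exp (- \<sigma> n * of_real (T - s)) * mode (w n) n (g s))
        \<le> exp (\<bar>Re l\<bar> * T) * ((l1 (W1 v* complex_matrix M) + l1 (W2 v* complex_matrix M)) / of_int n * norm (h s))"
      unfolding norm_mult using m by (intro mult_mono) auto
    have "cmod (mode (w n) n (S (T - s) (g s)) - exp (- \<sigma> n * of_real (T - s)) * mode (w n) n (g s))
        \<le> c1 / of_int n * norm (g s)"
      using n s by (intro approx) auto
    also have "\<dots> \<le> c1 / of_int n * (\<kappa> * norm (h s))"
      unfolding g using c1 n by (intro mult_left_mono \<kappa>) auto
    finally have "cmod (mode (w n) n (S (T - s) (g s))) \<le> c1 / of_int n * (\<kappa> * norm (h s))
        + exp (\<bar>Re l\<bar> * T) * ((l1 (W1 v* complex_matrix M) + l1 (W2 v* complex_matrix M)) / of_int n * norm (h s))"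
      using m2 norm_triangle_sub[of "mode (w n) n (S (T - s) (g s))"
          "exp (- \<sigma> n * of_real (T - s)) * mode (w n) n (g s)"] by linarith
    also have "\<dots> = c2 / of_int n * norm (h s)"
      by (simp add: c2_def algebra_simps add_divide_distrib)
    also have "\<dots> \<le> c2 / of_int n * \<rho> s"
      using n c1 \<kappa>(1) unfolding c2_def
      by (intro mult_left_mono hs divide_nonneg_nonneg add_nonneg_nonneg mult_nonneg_nonneg l1_nonneg) auto
    finally show ?thesis .
  qed
  have final: "cmod (mode (w n) n (S T f0)) \<le> c2 / of_int n * (\<integral>s. \<rho> s \<partial>?I)" if n: "n \<ge> 1" for n
  proof -
    have "has_bochner_integral ?I (\<lambda>s. mode (w n) n (S (T - s) (g s))) (mode (w n) n (- S T f0))"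
      by (rule has_bochner_integral_bounded_linear[OF bounded_linear_mode int])
    then have I: "integrable ?I (\<lambda>s. mode (w n) n (S (T - s) (g s)))"
      and eq: "(\<integral>s. mode (w n) n (S (T - s) (g s)) \<partial>?I) = - mode (w n) n (S T f0)"
      using bounded_linear_mode[of "w n" n]
      by (auto simp: has_bochner_integral_iff linear_simps)
    have "cmod (mode (w n) n (S T f0)) \<le> (\<integral>s. cmod (mode (w n) n (S (T - s) (g s))) \<partial>?I)"
      using integral_norm_bound[of ?I "\<lambda>s. mode (w n) n (S (T - s) (g s))"] unfolding eq by simp
    also have "\<dots> \<le> (\<integral>s. c2 / of_int n * \<rho> s \<partial>?I)"
    proof (rule integral_mono_AE)
      show "AE s in ?I. cmod (mode (w n) n (S (T - s) (g s))) \<le> c2 / of_int n * \<rho> s"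
        using AE_\<rho> AE_space
        by eventually_elim (use source[OF n] in \<open>auto simp: space_restrict_space\<close>)
    qed (use I \<rho> in auto)
    finally show ?thesis by simp
  qed
  have "cmod (mode (w n) n f0) \<le> exp (Re l * T) * (c2 * (\<integral>s. \<rho> s \<partial>?I) + c1 * norm f0) / of_int n"
    if n: "n \<ge> 1" for n
  proof -
    have "cmod (mode (w n) n (S T f0) - exp (- \<sigma> n * of_real T) * mode (w n) n f0) \<le> c1 / of_int n * norm f0"
      using T by (intro approx n) auto
    then have "cmod (exp (- \<sigma> n * of_real T) * mode (w n) n f0) \<le> c2 / of_int n * (\<integral>s. \<rho> s \<partial>?I) + c1 / of_int n * norm f0"
      using final[OF n] norm_triangle_sub[of "exp (- \<sigma> n * of_real T) * mode (w n) n f0" "mode (w n) n (S T f0)"]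
      by (simp add: norm_minus_commute)
    then have "exp (- (Re l * T)) * cmod (mode (w n) n f0) \<le> (c2 * (\<integral>s. \<rho> s \<partial>?I) + c1 * norm f0) / of_int n"
      by (simp add: norm_mult norm_exp_eq_Re Re_\<sigma> add_divide_distrib)
    then have "exp (Re l * T) * (exp (- (Re l * T)) * cmod (mode (w n) n f0))
        \<le> exp (Re l * T) * ((c2 * (\<integral>s. \<rho> s \<partial>?I) + c1 * norm f0) / of_int n)"
      by (rule mult_left_mono) simp
    then show ?thesis by (simp add: mult.assoc[symmetric] exp_add[symmetric])
  qed
  then show ?thesis unfolding w_def by blast
qed

theorem theorem3:
  fixes D :: "real^'p^'p"
    and A' :: "real^'h^'h" and A12 :: "real^'p^'h" and A21 :: "real^'h^'p" and A22 :: "real^'p^'p"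
    and A B K :: "real^('h + 'p)^('h + 'p)"
    and M :: "real^'m^('h + 'p)"
    and \<omega> :: "real set"
    and \<mu> T :: real
    and N :: nat
  assumes "CARD('m) \<le> CARD('h + 'p)"
    and "\<forall>z\<in>spectrum (complex_matrix D). Re z > 0"
    and "B = block_matrix 0 0 0 D"
    and "A = block_matrix A' A12 A21 A22"
    and "diagonalizable (complex_matrix A')"
    and "spectrum (complex_matrix A') \<subseteq> \<real>"
    and "open_torus \<omega>" and "\<omega> \<noteq> {}"
    and "complex_of_real \<mu> \<in> spectrum (complex_matrix A')"
    and "T > 0"
    and "\<And>f0 :: (real^('h + 'p)) L2. (\<forall>n. \<bar>n\<bar> \<le> int N \<longrightarrow> fourier_coeff f0 n = 0)
           \<Longrightarrow> steerable_to_zero B A K M \<omega> T f0"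
  shows "\<exists>V0. (transpose A' - mat \<mu>) *v V0 = 0 \<and> transpose M *v pad_zero V0 \<noteq> 0"
proof (rule ccontr)
  assume contra: "\<not> ?thesis"
  have D: "0 \<notin> spectrum (complex_matrix D)" using assms(2) by force
  obtain v W1 W2 l where v: "v \<noteq> 0" "v v* complex_matrix A' = of_real \<mu> *s v"
    and W: "pair_vec v 0 v* complex_matrix B = 0"
      "\<i> *s (pair_vec v 0 v* complex_matrix A - of_real \<mu> *s pair_vec v 0) + W1 v* complex_matrix B = 0"
      "pair_vec v 0 v* complex_matrix K - l *s pair_vec v 0
         + \<i> *s (W1 v* complex_matrix A - of_real \<mu> *s W1) + W2 v* complex_matrix B = 0"
    by (rule formal_hyperbolic_eigenvector[OF D assms(5,9,3,4), where K = K])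
  have M: "pair_vec v 0 v* complex_matrix M = 0"
    by (rule complex_row_kernel[OF _ v(2)]) (use contra in blast)
  define W0 where "W0 = (pair_vec v 0 :: complex^('h + 'p))"
  define z where "z = (\<chi> j. cnj (W0 $ j))"
  (* The weight 2^(-k) in the series is much larger than the bound C / \<nu> k, which is of order 4^(-k). *)
  define \<nu> where "\<nu> k = (int N + 1) * 4 ^ k" for k
  have \<nu>4: "4 ^ k \<le> \<nu> k" for k by (simp add: \<nu>_def)
  have "inj \<nu>" by (rule injI) (auto simp: \<nu>_def)
  moreover have "\<nu> k > int N" for k
  proof -
    have "(int N + 1) * 1 \<le> \<nu> k" unfolding \<nu>_def by (intro mult_left_mono) auto
    then show ?thesis by simp
  qed
  ultimately obtain f0 :: "(real^('h + 'p)) L2" where f0: "\<And>n. \<bar>n\<bar> \<le> int N \<Longrightarrow> fourier_coeff f0 n = 0"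
    and mode_f0: "\<And>k w. mode w (\<nu> k) f0 = (1 / 2) ^ k * (rowdot w z / 2)"
    using lacunary_series_exists[of \<nu> N W0] unfolding z_def by blast
  have "steerable_to_zero B A K M \<omega> T f0" by (intro assms(11)) (simp add: f0)
  from steerable_mode_bound[OF assms(3,10,7) W M this] obtain C
    where C: "\<And>n. n \<ge> 1 \<Longrightarrow> cmod (mode (expansion W0 W1 W2 n) n f0) \<le> C / of_int n"
    unfolding W0_def by blast
  define c where "c k = rowdot (expansion W0 W1 W2 (\<nu> k)) z" for k
  have c_bound: "cmod (c k) \<le> 2 * \<bar>C\<bar> * (1 / 2) ^ k" for k
  proof -
    have "1 \<le> (4 :: int) ^ k" by simp
    then have \<nu>1: "\<nu> k \<ge> 1" using \<nu>4[of k] by linarith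
    have "(4 :: real) ^ k = of_int (4 ^ k)" by simp
    also have "\<dots> \<le> of_int (\<nu> k)" using \<nu>4[of k] by (simp only: of_int_le_iff)
    finally have 4: "(4 :: real) ^ k \<le> of_int (\<nu> k)" .
    have "(1 / 2) ^ k * (cmod (c k) / 2) = cmod (mode (expansion W0 W1 W2 (\<nu> k)) (\<nu> k) f0)"
      by (simp add: mode_f0 c_def norm_mult norm_divide norm_power)
    also have "\<dots> \<le> C / of_int (\<nu> k)" by (rule C[OF \<nu>1])
    also have "\<dots> \<le> \<bar>C\<bar> / of_int (\<nu> k)" using \<nu>1 by (intro divide_right_mono) auto
    also have "\<dots> \<le> \<bar>C\<bar> / 4 ^ k" using 4 by (intro divide_left_mono) (use \<nu>1 in auto)
    also have "(4 :: real) ^ k = 2 ^ k * 2 ^ k" by (simp add: power_mult_distrib[symmetric])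
    finally show ?thesis by (simp add: field_simps)
  qed
  have "(\<lambda>k. 2 * \<bar>C\<bar> * (1 / 2) ^ k) \<longlonglongrightarrow> 2 * \<bar>C\<bar> * 0"
    by (intro tendsto_intros LIMSEQ_power_zero) simp
  then have "c \<longlonglongrightarrow> 0"
    by (intro Lim_null_comparison[OF always_eventually[OF allI[OF c_bound]]]) simp
  moreover have "c \<longlonglongrightarrow> rowdot W0 z"
  proof -
    have "(\<lambda>k. 1 / of_int (int N + 1) * (1 / 4 :: complex) ^ k) \<longlonglongrightarrow> 1 / of_int (int N + 1) * 0"
      by (intro tendsto_intros LIMSEQ_power_zero) (simp add: norm_divide)
    then have \<nu>0: "(\<lambda>k. 1 / complex_of_int (\<nu> k)) \<longlonglongrightarrow> 0"
      by (simp add: \<nu>_def power_divide)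
    have c_eq: "c k = rowdot W0 z + (1 / of_int (\<nu> k) * rowdot W1 z + (1 / of_int (\<nu> k))\<^sup>2 * rowdot W2 z)" for k
      by (simp add: c_def rowdot_def expansion_def algebra_simps sum.distrib sum_distrib_left power_divide)
    have "c \<longlonglongrightarrow> rowdot W0 z + (0 * rowdot W1 z + 0\<^sup>2 * rowdot W2 z)"
      unfolding c_eq[abs_def] by (intro tendsto_intros \<nu>0)
    then show ?thesis by simp
  qed
  ultimately have "rowdot W0 z = 0" using LIMSEQ_unique by blast
  moreover have "rowdot W0 z = of_real (\<Sum>j\<in>UNIV. (cmod (W0 $ j))\<^sup>2)"
    by (simp add: rowdot_def z_def complex_norm_square del: of_real_power)
  ultimately have "(\<Sum>j\<in>UNIV. (cmod (W0 $ j))\<^sup>2) = 0" by (simp only: of_real_eq_0_iff)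
  then have "W0 $ Inl j = 0" for j by (subst (asm) sum_nonneg_eq_0_iff) auto
  then have "v = 0" by (simp add: W0_def pair_vec_def vec_eq_iff)
  with v(1) show False ..
qed

end
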